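(* Let $q$ be a prime power, $r\ge1$ an integer, $\alpha_1,\ldots,\alpha_r$ independent Haar-random elements of $\mathfrak p=t^{-1}\mathbb F_q[[t^{-1}]]$, and let $p_r=1-q^{-r}$. For $N\ge1$ let $$C^{(r)}_N=1+\sum_{n=0}^{N-1}J^{(r)}_n,\qquad J^{(r)}_n=\mathbf 1_{\{L_r(n+1)>L_r(n)\}},$$ which is the number of distinct values among $L_r(0),L_r(1),\ldots,L_r(N)$. Then $C^{(r)}_N-1$ has the binomial distribution $\operatorname{Bin}(N,p_r)$ with $N$ trials and success probability $p_r$. Consequently, $$\frac{C^{(r)}_N}{N}\longrightarrow p_r\quad\text{almost surely as }N\to\infty,$$ and $$\frac{C^{(r)}_N-1-Np_r}{\sqrt{Np_r(1-p_r)}}$$ converges in distribution, as $N\to\infty$, to the standard normal distribution $\mathcal N(0,1)$. Moreover, almost surely, $$\limsup_{N\to\infty}\frac{C^{(r)}_N-1-Np_r}{\sqrt{2Np_r(1-p_r)\log\log N}}=1,$$ and the corresponding liminf equals $-1$.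
   Context: $\mathfrak p=t^{-1}\mathbb F_q[[t^{-1}]]\subset\mathbb F_q((t^{-1}))$, and $\mathfrak p^r$ carries product Haar probability measure. For $x\in\mathbb F_q((t^{-1}))$ the cancellation length $c(x)$ is the largest $n\ge0$ such that the coefficients of $t^{-1},\ldots,t^{-n}$ in $x$ all vanish ($c(x)=\infty$ if all negative coefficients vanish). For nonzero $Q\in\mathbb F_q[t]$, $d(Q)=\deg Q+1$. For $n\ge0$, $$L_r(n)=\min\{d(Q):0\ne Q\in\mathbb F_q[t],\ c(Q\alpha_i)\ge n\text{ for all }1\le i\le r\},$$ a nondecreasing function of $n$. *)

theory Defs
  imports
    "HOL-Probability.Probability"
    "HOL-Computational_Algebra.Formal_Laurent_Series"
begin

text \<open>
  The field of Laurent series in \<open>1/t\<close> over a finite field is represented by the library type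
  \<^typ>\<open>'a fls\<close> whose formal variable \<^term>\<open>fls_X\<close> stands for \<open>1/t\<close>. Hence \<open>t\<close> itself is
  \<^term>\<open>fls_X_inv\<close>, and the coefficient of \<open>t\<close> to the power \<open>-n\<close> in \<open>x\<close> is \<open>fls_nth x n\<close>.
\<close>

definition maximal_ideal :: "'a::field fls set" where
  "maximal_ideal = {x. \<forall>k\<le>0. fls_nth x k = 0}"

text \<open>
  The \<open>\<sigma>\<close>-algebra below is the Borel one for the metric topology of the library on
  \<^typ>\<open>'a fls\<close>, i.e. the \<open>(1/t)\<close>-adic topology.
\<close>

definition is_haar_probability :: "'a::{field,finite} fls measure \<Rightarrow> bool" where
  "is_haar_probability \<mu> \<longleftrightarrow>
     prob_space \<mu> \<and>
     space \<mu> = maximal_ideal \<and>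
     sets \<mu> = sets (restrict_space borel maximal_ideal) \<and>
     (\<forall>y\<in>maximal_ideal. \<forall>A\<in>sets \<mu>. emeasure \<mu> ((\<lambda>x. y + x) ` A) = emeasure \<mu> A)"

text \<open>A polynomial in \<open>t\<close> as a Laurent series in \<open>1/t\<close>: evaluation at \<open>t\<close>.\<close>

definition poly_in_t :: "'a::field poly \<Rightarrow> 'a fls" where
  "poly_in_t Q = poly (map_poly fls_const Q) fls_X_inv"

definition cancellation_length :: "'a::field fls \<Rightarrow> enat" where
  "cancellation_length x =
     (if \<forall>k\<ge>1::nat. fls_nth x (int k) = 0 then \<infinity>
      else enat (GREATEST n. \<forall>k\<in>{1..n}. fls_nth x (int k) = 0))"

text \<open>
  The argument \<open>a\<close> is the tuple of series, of which only the entries with index in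
  \<open>{1..r}\<close> are used. The set whose least element is taken is never empty: a nonzero
  \<open>Q\<close> of degree at most \<open>r * n\<close> has more coefficients than there are linear conditions.
\<close>

definition L_r :: "nat \<Rightarrow> (nat \<Rightarrow> 'a::field fls) \<Rightarrow> nat \<Rightarrow> nat" where
  "L_r r a n = (LEAST d. \<exists>Q. Q \<noteq> 0 \<and> d = degree Q + 1 \<and>
     (\<forall>i\<in>{1..r}. cancellation_length (poly_in_t Q * a i) \<ge> enat n))"

definition J_r :: "nat \<Rightarrow> (nat \<Rightarrow> 'a::field fls) \<Rightarrow> nat \<Rightarrow> nat" where
  "J_r r a n = of_bool (L_r r a (n + 1) > L_r r a n)"

definition C_r :: "nat \<Rightarrow> (nat \<Rightarrow> 'a::field fls) \<Rightarrow> nat \<Rightarrow> nat" where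
  "C_r r a N = 1 + (\<Sum>n<N. J_r r a n)"

end

theory Submission
  imports Defs "HOL-Real_Asymp.Real_Asymp"
begin

text \<open>
  \<^bold>\<open>The jumps are independent.\<close> The value \<open>L\<^sub>r(n)\<close> is the least \<open>d\<close> for which some nonzero \<open>Q\<close> of
  degree \<open>d - 1\<close> kills the coefficients of \<open>t\<close> to the powers \<open>-1, \<dots>, -n\<close> in all \<open>Q \<alpha>\<^sub>i\<close>. This
  \<open>Q\<close> is unique up to a scalar, and everything up to time \<open>n\<close> depends only on the coefficients
  of the \<open>\<alpha>\<^sub>i\<close> at the powers \<open>-1, \<dots>, -(n + d - 1)\<close>. There is no jump at \<open>n\<close> if and only if the
  same \<open>Q\<close> also kills the next coefficient in all \<open>Q \<alpha>\<^sub>i\<close>, and this condition involves the fresh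
  coefficients at the power \<open>-(n + d)\<close> through the nonzero leading coefficient of \<open>Q\<close>. So
  exactly one of the \<open>q\<^sup>r\<close> choices of the fresh coefficients avoids the jump
  (\<open>J_r_shift_unique\<close>). Since Haar measure is invariant under translation by a multiple of a
  power of \<open>1/t\<close>, the past splits into \<open>q\<^sup>r\<close> parts of equal probability
  (\<open>prob_no_jump_given_history\<close>). The jumps are therefore independent Bernoulli variables with
  success probability \<open>p = 1 - q\<^sup>-\<^sup>r\<close> (\<open>indep_vars_jumps\<close>), and their sum is binomial.

  \<^bold>\<open>The limit theorems.\<close> The central limit theorem then applies as it stands. The law of the
  iterated logarithm is proved for all bounded, centred, independent and identically
  distributed variables (\<open>law_of_the_iterated_logarithm\<close>). Its upper half
  (\<open>eventually_less_iterated_log_scale\<close>) rests on an exponential maximal inequality along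
  geometric blocks of time. Its lower half (\<open>frequently_ge_iterated_log_scale\<close>) builds
  large deviations out of logarithmically many blocks, each of which exceeds a fixed multiple of
  its standard deviation with a probability controlled by the central limit theorem; the
  second Borel--Cantelli lemma makes this happen infinitely often. The strong law follows from
  the upper half.
\<close>

section \<open>Polynomial approximation and the minimal value of \<open>d(Q)\<close>\<close>

lemma fls_nth_sum: "fls_nth (\<Sum>i\<in>I. f i) k = (\<Sum>i\<in>I. fls_nth (f i) k)"
  by (induction I rule: infinite_finite_induct) auto

text \<open>
  The upper limit \<open>D\<close> is left free so that polynomials of different degrees can be
  compared coefficient by coefficient.
\<close>

lemma fls_nth_poly_in_t_mult:
  assumes "degree Q \<le> D"
  shows "fls_nth (poly_in_t Q * x) k = (\<Sum>j\<le>D. coeff Q j * fls_nth x (k + int j))"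
proof -
  have "degree (map_poly fls_const Q) = degree Q" by (rule degree_map_poly) simp
  then have "poly_in_t Q * x = (\<Sum>j\<le>degree Q. fls_const (coeff Q j) * (fls_X_inv ^ j * x))"
    by (simp add: poly_in_t_def poly_altdef coeff_map_poly sum_distrib_right mult.assoc)
  then have "fls_nth (poly_in_t Q * x) k = (\<Sum>j\<le>degree Q. coeff Q j * fls_nth x (k + int j))"
    by (simp add: fls_nth_sum fls_X_inv_power_times_conv_shift)
  also have "\<dots> = (\<Sum>j\<le>D. coeff Q j * fls_nth x (k + int j))"
    by (rule sum.mono_neutral_left) (use assms in \<open>auto simp: coeff_eq_0\<close>)
  finally show ?thesis .
qed

lemma fls_nth_poly_in_t_diff_smult_mult:
  "fls_nth (poly_in_t (smult u P - smult v Q) * x) k =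
     u * fls_nth (poly_in_t P * x) k - v * fls_nth (poly_in_t Q * x) k"
proof -
  define D where "D = max (degree (smult u P - smult v Q)) (max (degree P) (degree Q))"
  have "fls_nth (poly_in_t (smult u P - smult v Q) * x) k =
        (\<Sum>j\<le>D. coeff (smult u P - smult v Q) j * fls_nth x (k + int j))"
    by (rule fls_nth_poly_in_t_mult) (simp add: D_def)
  moreover have "fls_nth (poly_in_t P * x) k = (\<Sum>j\<le>D. coeff P j * fls_nth x (k + int j))"
    by (rule fls_nth_poly_in_t_mult) (simp add: D_def)
  moreover have "fls_nth (poly_in_t Q * x) k = (\<Sum>j\<le>D. coeff Q j * fls_nth x (k + int j))"
    by (rule fls_nth_poly_in_t_mult) (simp add: D_def)
  ultimately show ?thesis
    by (simp add: sum_distrib_left sum_subtractf algebra_simps)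
qed

lemma cancellation_length_ge_iff:
  "enat n \<le> cancellation_length x \<longleftrightarrow> (\<forall>k\<in>{1..n}. fls_nth x (int k) = 0)"
proof (cases "\<forall>k\<ge>1::nat. fls_nth x (int k) = 0")
  case False
  then obtain K :: nat where K: "K \<ge> 1" "fls_nth x (int K) \<noteq> 0" by auto
  let ?P = "\<lambda>n. \<forall>k\<in>{1..n}. fls_nth x (int k) = 0"
  have bound: "\<And>y. ?P y \<Longrightarrow> y \<le> K" using K by (metis atLeastAtMost_iff linorder_le_cases)
  have 1: "?P (GREATEST n. ?P n)" by (rule GreatestI_nat[of ?P 0, OF _ bound]) auto
  have 2: "?P n \<Longrightarrow> n \<le> (GREATEST n. ?P n)" by (rule Greatest_le_nat[of ?P, OF _ bound]) auto
  have "n \<le> (GREATEST n. ?P n) \<longleftrightarrow> ?P n"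
  proof
    assume "n \<le> (GREATEST n. ?P n)"
    with 1 show "?P n" by (meson atLeastAtMost_iff order_trans)
  qed (rule 2)
  moreover have "cancellation_length x = enat (GREATEST n. ?P n)"
    unfolding cancellation_length_def using False by (rule if_not_P)
  ultimately show ?thesis by simp
qed (auto simp: cancellation_length_def)

text \<open>
  By the preceding lemma, this is the condition \<open>c(Q \<alpha>\<^sub>i) \<ge> n\<close> for all \<open>i\<close> in the definition of
  \<open>L\<^sub>r(n)\<close>; in this form it is visibly linear in \<open>Q\<close>.
\<close>

definition approximates :: "nat \<Rightarrow> (nat \<Rightarrow> 'a::field fls) \<Rightarrow> nat \<Rightarrow> 'a poly \<Rightarrow> bool" where
  "approximates r a n Q \<longleftrightarrow>
     (\<forall>i\<in>{1..r}. \<forall>k\<in>{1..n}. fls_nth (poly_in_t Q * a i) (int k) = 0)"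

lemma L_r_altdef:
  "L_r r a n = (LEAST d. \<exists>Q. Q \<noteq> 0 \<and> d = degree Q + 1 \<and> approximates r a n Q)"
  by (simp add: L_r_def approximates_def cancellation_length_ge_iff)

lemma approximates_antimono: "approximates r a n Q \<Longrightarrow> m \<le> n \<Longrightarrow> approximates r a m Q"
  by (auto simp: approximates_def)

lemma approximates_cong:
  "(\<And>i. i \<in> {1..r} \<Longrightarrow> a i = b i) \<Longrightarrow> approximates r a n Q = approximates r b n Q"
  by (simp add: approximates_def)

lemma approximates_diff_smult:
  "approximates r a n P \<Longrightarrow> approximates r a n Q \<Longrightarrow> approximates r a n (smult u P - smult v Q)"
  by (simp add: approximates_def fls_nth_poly_in_t_diff_smult_mult)

text \<open>
  There are infinitely many polynomials, but only finitely many possible values for the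
  tuple of coefficients that have to vanish. Two polynomials with the same tuple differ by a
  solution.
\<close>

lemma approximates_exists:
  fixes a :: "nat \<Rightarrow> 'a::{field,finite} fls"
  shows "\<exists>Q. Q \<noteq> 0 \<and> approximates r a n Q"
proof -
  define v :: "'a poly \<Rightarrow> nat \<times> nat \<Rightarrow> 'a" where
    "v Q = restrict (\<lambda>(i, k). fls_nth (poly_in_t Q * a i) (int k)) ({1..r} \<times> {1..n})" for Q
  have "range v \<subseteq> ({1..r} \<times> {1..n}) \<rightarrow>\<^sub>E UNIV" 
    unfolding v_def by (intro image_subsetI restrict_PiE_iff[THEN iffD2]) simp
  moreover have "finite (({1..r} \<times> {1..n}) \<rightarrow>\<^sub>E (UNIV :: 'a set))"
    by (intro finite_PiE) auto
  ultimately have "finite (range v)" by (rule finite_subset)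
  moreover have "infinite (UNIV :: 'a poly set)"
  proof -
    have "inj (\<lambda>n. monom (1::'a) n)" by (rule injI) (simp add: monom_eq_iff')
    then show ?thesis using finite_subset[OF subset_UNIV] range_inj_infinite by blast
  qed
  ultimately have "\<not> inj v" using finite_imageD by blast
  then obtain P Q where PQ: "v P = v Q" "P \<noteq> Q" by (auto simp: inj_def)
  have "approximates r a n (smult 1 P - smult 1 Q)"
    unfolding approximates_def fls_nth_poly_in_t_diff_smult_mult
  proof (intro ballI)
    fix i k assume "i \<in> {1..r}" "k \<in> {1..n}"
    then show "1 * fls_nth (poly_in_t P * a i) (int k) - 1 * fls_nth (poly_in_t Q * a i) (int k) = 0"
      using fun_cong[OF PQ(1), of "(i, k)"] by (simp add: v_def)
  qed
  with PQ(2) show ?thesis by (intro exI[of _ "P - Q"]) simp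
qed

lemma L_r_witness:
  fixes a :: "nat \<Rightarrow> 'a::{field,finite} fls"
  obtains Q where "Q \<noteq> 0" "degree Q + 1 = L_r r a n" "approximates r a n Q"
proof -
  have "\<exists>d Q. Q \<noteq> 0 \<and> d = degree Q + 1 \<and> approximates r a n Q"
    using approximates_exists[of r a n] by blast
  from LeastI_ex[OF this] that show ?thesis unfolding L_r_altdef by metis
qed

lemma L_r_le: "Q \<noteq> 0 \<Longrightarrow> approximates r a n Q \<Longrightarrow> L_r r a n \<le> degree Q + 1"
  unfolding L_r_altdef by (rule Least_le) blast

lemma L_r_le_iff:
  fixes a :: "nat \<Rightarrow> 'a::{field,finite} fls"
  shows "L_r r a n \<le> d \<longleftrightarrow> (\<exists>Q. Q \<noteq> 0 \<and> degree Q < d \<and> approximates r a n Q)"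
  by (metis L_r_le L_r_witness Suc_eq_plus1 Suc_le_eq order_trans)

lemma L_r_cong:
  "(\<And>i. i \<in> {1..r} \<Longrightarrow> a i = b i) \<Longrightarrow> L_r r a n = L_r r b n"
  unfolding L_r_altdef using approximates_cong[of r a b] by simp

lemma L_r_mono:
  fixes a :: "nat \<Rightarrow> 'a::{field,finite} fls"
  shows "mono (L_r r a)"
proof (rule monoI)
  fix m n :: nat assume "m \<le> n"
  obtain Q where Q: "Q \<noteq> 0" "degree Q + 1 = L_r r a n" "approximates r a n Q"
    by (rule L_r_witness)
  with \<open>m \<le> n\<close> have "approximates r a m Q" by (metis approximates_antimono)
  with Q show "L_r r a m \<le> L_r r a n" by (metis L_r_le)
qed

lemma card_image_mono_eq:
  fixes f :: "nat \<Rightarrow> nat"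
  assumes "mono f"
  shows "card (f ` {0..N}) = 1 + (\<Sum>n<N. of_bool (f (n + 1) > f n))"
proof (induction N)
  case (Suc N)
  have le: "y \<le> f N" if "y \<in> f ` {0..N}" for y
    using that assms by (auto simp: mono_def)
  have img: "f ` {0..Suc N} = insert (f (Suc N)) (f ` {0..N})"
    by (simp add: atLeast0_atMost_Suc)
  show ?case
  proof (cases "f (Suc N) > f N")
    case True
    then have "f (Suc N) \<notin> f ` {0..N}" using le by fastforce
    with True Suc show ?thesis by (simp add: img)
  next
    case False
    with assms have "f (Suc N) = f N" by (simp add: mono_def order.antisym)
    then show ?thesis using Suc by (simp add: img insert_absorb)
  qed
qed simp

lemma C_r_eq_card:
  fixes a :: "nat \<Rightarrow> 'a::{field,finite} fls"
  shows "C_r r a N = card (L_r r a ` {0..N})"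
  by (simp add: card_image_mono_eq[OF L_r_mono] C_r_def J_r_def)

text \<open>
  Eliminating the leading terms of two solutions of minimal degree leaves a solution of
  smaller degree, which must vanish.
\<close>

lemma minimal_approximation_unique:
  fixes a :: "nat \<Rightarrow> 'a::{field,finite} fls"
  assumes P: "P \<noteq> 0" "degree P + 1 = L_r r a n" "approximates r a n P"
    and Q: "Q \<noteq> 0" "degree Q + 1 = L_r r a n" "approximates r a n Q"
  shows "smult (lead_coeff Q) P = smult (lead_coeff P) Q"
proof (rule ccontr)
  let ?R = "smult (lead_coeff Q) P - smult (lead_coeff P) Q"
  assume "\<not> ?thesis"
  then have R: "?R \<noteq> 0" by simp
  have "approximates r a n ?R" using P Q by (intro approximates_diff_smult)
  from L_r_le[OF R this] have "degree P \<le> degree ?R" using P by simp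
  moreover have "degree ?R \<le> degree P" using P Q by (intro degree_diff_le) auto
  moreover have "coeff ?R (degree P) = 0"
  proof -
    have "degree P = degree Q" using P(2) Q(2) by simp
    then show ?thesis by simp
  qed
  ultimately have "lead_coeff ?R = 0" by (metis order.antisym)
  with R show False by (simp only: leading_coeff_0_iff)
qed

text \<open>
  Since the minimal solution is unique up to a scalar, \<open>L\<^sub>r\<close> does not jump at \<open>n\<close> exactly
  when this one solution passes the next test. This turns the jump into a condition on
  finitely many coefficients.
\<close>

lemma J_r_eq_0_iff:
  fixes a :: "nat \<Rightarrow> 'a::{field,finite} fls"
  assumes Q: "Q \<noteq> 0" "degree Q + 1 = L_r r a n" "approximates r a n Q"
  shows "J_r r a n = 0 \<longleftrightarrow> approximates r a (n + 1) Q"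
proof
  assume "J_r r a n = 0"
  then have "L_r r a (n + 1) = L_r r a n"
    using monoD[OF L_r_mono[of r a], of n "n + 1"] by (simp add: J_r_def)
  then obtain P where P: "P \<noteq> 0" "degree P + 1 = L_r r a n" "approximates r a (n + 1) P"
    by (metis L_r_witness)
  from P have "smult (lead_coeff P) Q = smult (lead_coeff Q) P"
    by (intro minimal_approximation_unique[OF Q]) (auto intro: approximates_antimono)
  then have "Q = smult (lead_coeff Q / lead_coeff P) P"
    using P(1) by (metis (no_types, lifting) divide_inverse leading_coeff_0_iff left_inverse mult.commute smult_1_left smult_smult)
  also have "\<dots> = smult (lead_coeff Q / lead_coeff P) P - smult 0 P" by simp
  finally show "approximates r a (n + 1) Q"
    using approximates_diff_smult[OF P(3) P(3)] by metis
next
  assume "approximates r a (n + 1) Q"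
  with Q have "L_r r a (n + 1) \<le> L_r r a n" by (metis L_r_le)
  then show "J_r r a n = 0" by (simp add: J_r_def)
qed

section \<open>Perturbing the first coefficient that does not affect \<open>L\<^sub>r(n)\<close>\<close>

definition single_coeff :: "nat \<Rightarrow> 'a::field \<Rightarrow> 'a fls" where
  "single_coeff m v = fls_shift (- int m) (fls_const v)"

lemma fls_nth_single_coeff: "fls_nth (single_coeff m v) k = (if k = int m then v else 0)"
  by (simp add: single_coeff_def)

lemma fls_nth_poly_in_t_mult_single_coeff:
  "fls_nth (poly_in_t Q * (single_coeff m v + x)) (int k) =
     (if k \<le> m then coeff Q (m - k) * v else 0) + fls_nth (poly_in_t Q * x) (int k)"
proof -
  have "fls_nth (poly_in_t Q * single_coeff m v) (int k) =
        (\<Sum>j\<le>max m (degree Q). coeff Q j * (if int k + int j = int m then v else 0))"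
    by (subst fls_nth_poly_in_t_mult[of Q "max m (degree Q)"]) (auto simp: fls_nth_single_coeff)
  also have "\<dots> = (\<Sum>j\<le>max m (degree Q). if j = m - k then (if k \<le> m then coeff Q (m - k) * v else 0) else 0)"
    by (intro sum.cong) auto
  also have "\<dots> = (if k \<le> m then coeff Q (m - k) * v else 0)"
    by (subst sum.delta) auto
  finally show ?thesis by (simp add: distrib_left)
qed

lemma approximates_shift:
  assumes "m + degree Q < n"
  shows "approximates r (\<lambda>i. single_coeff n (v i) + a i) m Q = approximates r a m Q"
proof -
  have "coeff Q (n - k) = 0" if "k \<in> {1..m}" for k
    using assms that by (intro coeff_eq_0) auto
  then show ?thesis
    by (simp add: approximates_def fls_nth_poly_in_t_mult_single_coeff)
qed

text \<open>
  With \<open>d = L\<^sub>r(n)\<close>, the tests that decide the values \<open>L\<^sub>r(0), \<dots>, L\<^sub>r(n)\<close> involve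
  polynomials of degree below \<open>d\<close> and hence only coefficients of \<open>t\<close> to the powers
  \<open>-1, \<dots>, -(n + d - 1)\<close>. Changing the next coefficient goes unnoticed.
\<close>

lemma L_r_shift:
  fixes a :: "nat \<Rightarrow> 'a::{field,finite} fls"
  assumes "m \<le> n"
  shows "L_r r (\<lambda>i. single_coeff (n + L_r r a n) (v i) + a i) m = L_r r a m"
    (is "L_r r ?b m = _")
proof -
  have eq: "approximates r ?b m Q = approximates r a m Q" if "degree Q < L_r r a n" for Q
    using that assms by (intro approximates_shift) simp
  have le: "L_r r a m \<le> L_r r a n" using L_r_mono assms by (rule monoD)
  have "L_r r ?b m \<le> d \<longleftrightarrow> L_r r a m \<le> d" if "d \<le> L_r r a n" for d
    unfolding L_r_le_iff using eq that by (metis order.strict_trans2)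
  from this[OF le] this[of "L_r r ?b m"] le show ?thesis by linarith
qed

text \<open>
  The next test, by contrast, sees the perturbed coefficient: for each \<open>i\<close>, it is an affine
  function of \<open>v i\<close> whose slope is the leading coefficient of the minimal solution. So exactly
  one of the \<open>q\<^sup>r\<close> perturbations suppresses the jump at \<open>n\<close>.
\<close>

lemma J_r_shift_unique:
  fixes a :: "nat \<Rightarrow> 'a::{field,finite} fls"
  shows "\<exists>!v. v \<in> {1..r} \<rightarrow>\<^sub>E UNIV \<and> J_r r (\<lambda>i. single_coeff (n + L_r r a n) (v i) + a i) n = 0"
proof -
  obtain Q where Q: "Q \<noteq> 0" "degree Q + 1 = L_r r a n" "approximates r a n Q"
    by (rule L_r_witness)
  define y where "y i = fls_nth (poly_in_t Q * a i) (int (n + 1))" for i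
  have J: "J_r r (\<lambda>i. single_coeff (n + L_r r a n) (v i) + a i) n = 0 \<longleftrightarrow>
           (\<forall>i\<in>{1..r}. lead_coeff Q * v i + y i = 0)" for v
  proof -
    let ?b = "\<lambda>i. single_coeff (n + L_r r a n) (v i) + a i"
    have "approximates r ?b n Q = approximates r a n Q"
      using Q(2) by (intro approximates_shift) simp
    then have appr: "approximates r ?b n Q" using Q by simp
    have "J_r r ?b n = 0 \<longleftrightarrow> approximates r ?b (n + 1) Q"
      using appr Q by (intro J_r_eq_0_iff) (auto simp: L_r_shift)
    also have "\<dots> \<longleftrightarrow> (\<forall>i\<in>{1..r}. fls_nth (poly_in_t Q * ?b i) (int (n + 1)) = 0)"
    proof -
      have "{1..n + 1} = insert (n + 1) {1..n}" by auto
      then show ?thesis using appr unfolding approximates_def by (simp only: ball_simps) blast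
    qed
    also have "\<dots> \<longleftrightarrow> (\<forall>i\<in>{1..r}. lead_coeff Q * v i + y i = 0)"
      using Q(2) by (simp only: fls_nth_poly_in_t_mult_single_coeff y_def flip: Q(2)) simp
    finally show ?thesis .
  qed
  have sol: "lead_coeff Q * w + y i = 0 \<longleftrightarrow> w = - y i / lead_coeff Q" for w i
    using Q(1) by (simp add: field_simps add_eq_0_iff)
  show ?thesis unfolding J sol
    by (rule ex1I[of _ "\<lambda>i\<in>{1..r}. - y i / lead_coeff Q"]) (auto simp: PiE_def extensional_def fun_eq_iff)
qed

section \<open>Measurability\<close>

text \<open>
  The metric is translation invariant, so translations are isometries and therefore
  Borel measurable.
\<close>

lemma dist_fls_translate: "dist (y + x) (y + z) = dist x (z :: 'a::ab_group_add fls)"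
  by (simp add: dist_fls_def)

lemma borel_measurable_fls_translate [measurable]:
  "(\<lambda>x :: 'a::ab_group_add fls. y + x) \<in> borel_measurable borel"
proof (rule borel_measurable_continuous_onI)
  show "continuous_on UNIV ((+) y)"
    unfolding continuous_on_iff by (auto simp: dist_fls_translate)
qed

lemma fls_nth_eq_of_dist_less:
  assumes "dist x y < inverse (2 ^ k)"
  shows "fls_nth x (int k) = fls_nth (y :: 'a::ab_group_add fls) (int k)"
proof (rule ccontr)
  assume neq: "\<not> ?thesis"
  then have "fls_subdegree (x - y) \<le> int k" by (intro fls_subdegree_leI) simp
  moreover have "x \<noteq> y" using neq by auto
  ultimately have "inverse (2 ^ k) \<le> dist x y"
  proof (cases "fls_subdegree (x - y) \<ge> 0")
    case True
    have "(2::real) ^ nat (fls_subdegree (x - y)) \<le> 2 ^ k"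
      using \<open>fls_subdegree (x - y) \<le> int k\<close> by (intro power_increasing) auto
    then show ?thesis using \<open>x \<noteq> y\<close> True by (simp add: dist_fls_def field_simps)
  next
    case False
    have "inverse (2 ^ k) \<le> (1 :: real)" by (simp add: field_simps)
    also have "1 \<le> (2::real) ^ nat (- fls_subdegree (x - y))" by simp
    finally show ?thesis using \<open>x \<noteq> y\<close> False by (simp add: dist_fls_def)
  qed
  with assms show False by simp
qed

text \<open>
  Series at distance less than \<open>2\<^sup>-\<^sup>k\<close> share their coefficient of index \<open>k\<close>, so the level
  sets of this coefficient are open.
\<close>

lemma measurable_fls_nth [measurable]:
  "(\<lambda>x :: 'a::{ab_group_add,finite} fls. fls_nth x (int k)) \<in> borel \<rightarrow>\<^sub>M count_space UNIV"
proof (subst measurable_count_space_eq2)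
  have "open ((\<lambda>x. fls_nth x (int k)) -` {c})" for c :: 'a
    unfolding open_dist
    by (auto intro!: exI[of _ "inverse (2 ^ k)"] dest: fls_nth_eq_of_dist_less)
  then show "(\<lambda>x. fls_nth x (int k)) \<in> space borel \<rightarrow> UNIV \<and>
    (\<forall>a\<in>UNIV. (\<lambda>x::'a fls. fls_nth x (int k)) -` {a} \<inter> space borel \<in> sets borel)"
    by simp
qed simp

lemma measurable_finite_binop:
  fixes f g :: "'b \<Rightarrow> 'a::finite"
  assumes f: "f \<in> N \<rightarrow>\<^sub>M count_space UNIV" and g: "g \<in> N \<rightarrow>\<^sub>M count_space UNIV"
  shows "(\<lambda>x. h (f x) (g x)) \<in> N \<rightarrow>\<^sub>M count_space UNIV"
proof (rule measurable_compose_countable[OF _ f])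
  show "(\<lambda>x. h i (g x)) \<in> N \<rightarrow>\<^sub>M count_space UNIV" for i
    using g by (rule measurable_compose) simp
qed

lemma measurable_finite_type_sum:
  fixes f :: "'i \<Rightarrow> 'b \<Rightarrow> 'a::{comm_monoid_add,finite}"
  assumes "\<And>i. i \<in> I \<Longrightarrow> f i \<in> N \<rightarrow>\<^sub>M count_space UNIV"
  shows "(\<lambda>x. \<Sum>i\<in>I. f i x) \<in> N \<rightarrow>\<^sub>M count_space UNIV"
  using assms
proof (induction I rule: infinite_finite_induct)
  case (insert i I)
  have "f i \<in> N \<rightarrow>\<^sub>M count_space UNIV" "(\<lambda>x. \<Sum>i\<in>I. f i x) \<in> N \<rightarrow>\<^sub>M count_space UNIV"
    using insert by auto
  then have "(\<lambda>x. f i x + (\<Sum>i\<in>I. f i x)) \<in> N \<rightarrow>\<^sub>M count_space UNIV"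
    by (rule measurable_finite_binop)
  then show ?case using insert(1,2) by simp
qed auto

lemma measurable_approximates:
  fixes f :: "nat \<Rightarrow> 'b \<Rightarrow> 'a::{field,finite} fls"
  assumes [measurable]: "\<And>i. i \<in> {1..r} \<Longrightarrow> f i \<in> borel_measurable N"
  shows "Measurable.pred N (\<lambda>\<omega>. approximates r (\<lambda>i. f i \<omega>) n Q)"
proof -
  have [measurable]: "(\<lambda>\<omega>. fls_nth (poly_in_t Q * f i \<omega>) (int k)) \<in> N \<rightarrow>\<^sub>M count_space UNIV"
    if "i \<in> {1..r}" for i k
  proof -
    have [measurable]: "(\<lambda>\<omega>. fls_nth (f i \<omega>) (int k)) \<in> N \<rightarrow>\<^sub>M count_space UNIV" for k
      using measurable_compose[OF assms[OF that] measurable_fls_nth] by simp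
    have "(\<lambda>\<omega>. coeff Q j * fls_nth (f i \<omega>) (int (k + j))) \<in> N \<rightarrow>\<^sub>M count_space UNIV" for j
      using measurable_const by (rule measurable_finite_binop) measurable
    then show ?thesis
      by (simp add: fls_nth_poly_in_t_mult[OF order.refl] measurable_finite_type_sum)
  qed
  show ?thesis unfolding approximates_def by measurable
qed

lemma finite_degree_less:
  "finite {Q :: 'a::{zero,finite} poly. degree Q < d}"
proof (rule finite_imageD[of coeffs])
  have "coeffs ` {Q :: 'a poly. degree Q < d} \<subseteq> {xs. set xs \<subseteq> UNIV \<and> length xs \<le> d}"
  proof (intro image_subsetI CollectI conjI subset_UNIV)
    fix Q :: "'a poly" assume "Q \<in> {Q. degree Q < d}"
    then show "length (coeffs Q) \<le> d" by (cases "Q = 0") (auto simp: length_coeffs_degree)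
  qed
  then show "finite (coeffs ` {Q :: 'a poly. degree Q < d})"
    by (rule finite_subset) (rule finite_lists_length_le, simp)
  show "inj_on coeffs {Q :: 'a poly. degree Q < d}"
    by (rule inj_onI) (simp add: coeffs_eq_iff)
qed

lemma measurable_L_r:
  fixes f :: "nat \<Rightarrow> 'b \<Rightarrow> 'a::{field,finite} fls"
  assumes "\<And>i. i \<in> {1..r} \<Longrightarrow> f i \<in> borel_measurable N"
  shows "(\<lambda>\<omega>. L_r r (\<lambda>i. f i \<omega>) n) \<in> N \<rightarrow>\<^sub>M count_space UNIV"
proof -
  have [measurable]: "Measurable.pred N (\<lambda>\<omega>. approximates r (\<lambda>i. f i \<omega>) n Q)" for Q
    using assms by (rule measurable_approximates)
  have "(\<exists>Q. Q \<noteq> 0 \<and> d = degree Q + 1 \<and> approximates r (\<lambda>i. f i \<omega>) n Q) =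
     (\<exists>Q\<in>{Q. degree Q < d}. Q \<noteq> 0 \<and> d = degree Q + 1 \<and> approximates r (\<lambda>i. f i \<omega>) n Q)" for d \<omega>
    by auto
  moreover have "Measurable.pred N (\<lambda>\<omega>. \<exists>Q\<in>{Q. degree Q < d}.
      Q \<noteq> 0 \<and> d = degree Q + 1 \<and> approximates r (\<lambda>i. f i \<omega>) n Q)" for d
    using finite_degree_less by (rule pred_intros_finite) measurable
  ultimately show ?thesis unfolding L_r_altdef by (intro measurable_Least) simp
qed

text \<open>
  Events that concern finitely many values of \<open>L\<^sub>r\<close> are handled through the list of these
  values, which ranges over a countable type.
\<close>

lemma measurable_L_r_history:
  fixes f :: "nat \<Rightarrow> 'b \<Rightarrow> 'a::{field,finite} fls"
  assumes "\<And>i. i \<in> {1..r} \<Longrightarrow> f i \<in> borel_measurable N"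
  shows "(\<lambda>\<omega>. map (L_r r (\<lambda>i. f i \<omega>)) [0..<m]) \<in> N \<rightarrow>\<^sub>M count_space UNIV"
proof (induction m)
  case (Suc m)
  note [measurable] = Suc measurable_L_r[OF assms]
  show ?case by simp
qed simp

section \<open>The jumps are independent\<close>

locale haar_sample = prob_space M
  for M :: "'w measure" and \<mu> :: "'a::{field,finite} fls measure"
    and \<alpha> :: "nat \<Rightarrow> 'w \<Rightarrow> 'a fls" and r :: nat +
  assumes r_pos: "r \<ge> 1"
    and haar: "is_haar_probability \<mu>"
    and indep: "indep_vars (\<lambda>_. \<mu>) \<alpha> {1..r}"
    and law: "\<And>i. i \<in> {1..r} \<Longrightarrow> distr M \<mu> (\<alpha> i) = \<mu>"
begin

abbreviation sample :: "'w \<Rightarrow> nat \<Rightarrow> 'a fls" where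
  "sample \<omega> \<equiv> \<lambda>i. \<alpha> i \<omega>"

lemma space_haar: "space \<mu> = maximal_ideal"
  and sets_haar: "sets \<mu> = sets (restrict_space borel maximal_ideal)"
  using haar by (auto simp: is_haar_probability_def)

lemma measurable_haar_borel: "(\<lambda>x. x) \<in> \<mu> \<rightarrow>\<^sub>M borel"
  by (subst measurable_cong_sets[OF sets_haar refl]) (rule measurable_restrict_space1, simp)

lemma measurable_translate_haar:
  assumes "y \<in> maximal_ideal"
  shows "(\<lambda>x. y + x) \<in> \<mu> \<rightarrow>\<^sub>M \<mu>"
proof (subst measurable_cong_sets[OF sets_haar sets_haar])
  show "(\<lambda>x. y + x) \<in> restrict_space borel maximal_ideal \<rightarrow>\<^sub>M restrict_space borel maximal_ideal"
    using assms by (intro measurable_restrict_space3) (auto simp: maximal_ideal_def)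
qed

lemma distr_translate_haar:
  assumes y: "y \<in> maximal_ideal"
  shows "distr \<mu> \<mu> (\<lambda>x. y + x) = \<mu>"
proof (rule measure_eqI)
  fix A assume "A \<in> sets (distr \<mu> \<mu> (\<lambda>x. y + x))"
  then have A: "A \<in> sets \<mu>" by simp
  have y': "- y \<in> maximal_ideal" using y by (simp add: maximal_ideal_def)
  have "A \<subseteq> maximal_ideal" using sets.sets_into_space[OF A] space_haar by simp
  then have "(\<lambda>x. y + x) -` A \<inter> space \<mu> = (\<lambda>x. - y + x) ` A"
    using y by (force simp: space_haar maximal_ideal_def image_iff)
  then show "emeasure (distr \<mu> \<mu> (\<lambda>x. y + x)) A = emeasure \<mu> A"
    using haar y' A unfolding is_haar_probability_def
    by (metis emeasure_distr[OF measurable_translate_haar[OF y] A])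
qed simp

lemma measurable_sample: "i \<in> {1..r} \<Longrightarrow> \<alpha> i \<in> M \<rightarrow>\<^sub>M \<mu>"
  using indep by (simp add: indep_vars_def)

lemma measurable_sample_borel: "i \<in> {1..r} \<Longrightarrow> \<alpha> i \<in> borel_measurable M"
  using measurable_compose[OF measurable_sample measurable_haar_borel] by simp

text \<open>
  Haar measure is translation invariant, hence so is its \<open>r\<close>-fold product.
\<close>

lemma joint_law_translate:
  assumes y: "\<And>i. y i \<in> maximal_ideal"
  shows "distr M (PiM {1..r} (\<lambda>_. \<mu>)) (\<lambda>\<omega>. \<lambda>i\<in>{1..r}. y i + \<alpha> i \<omega>) = PiM {1..r} (\<lambda>_. \<mu>)"
proof -
  have meas: "(\<lambda>\<omega>. y i + \<alpha> i \<omega>) \<in> M \<rightarrow>\<^sub>M \<mu>" if "i \<in> {1..r}" for i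
    using measurable_compose[OF measurable_sample[OF that] measurable_translate_haar[OF y]] .
  have "indep_vars (\<lambda>_. \<mu>) (\<lambda>i \<omega>. y i + \<alpha> i \<omega>) {1..r}"
    using indep measurable_translate_haar[OF y] by (rule indep_vars_compose2)
  moreover have "distr M \<mu> (\<lambda>\<omega>. y i + \<alpha> i \<omega>) = \<mu>" if "i \<in> {1..r}" for i
  proof -
    have "distr M \<mu> (\<lambda>\<omega>. y i + \<alpha> i \<omega>) = distr (distr M \<mu> (\<alpha> i)) \<mu> (\<lambda>x. y i + x)"
      by (subst distr_distr[OF measurable_translate_haar[OF y] measurable_sample[OF that]]) (simp add: comp_def)
    then show ?thesis by (simp add: law[OF that] distr_translate_haar[OF y])
  qed
  moreover from this have "PiM {1..r} (\<lambda>i. distr M \<mu> (\<lambda>\<omega>. y i + \<alpha> i \<omega>)) = PiM {1..r} (\<lambda>_. \<mu>)"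
    by (intro PiM_cong) auto
  ultimately show ?thesis
    using r_pos meas by (subst (asm) indep_vars_iff_distr_eq_PiM') auto
qed

lemma single_coeff_in_maximal_ideal: "m \<ge> 1 \<Longrightarrow> single_coeff m v \<in> maximal_ideal"
  by (auto simp: maximal_ideal_def fls_nth_single_coeff)

lemma measurable_history_sample [measurable]:
  "(\<lambda>\<omega>. map (L_r r (sample \<omega>)) [0..<N]) \<in> M \<rightarrow>\<^sub>M count_space UNIV"
  using measurable_sample_borel by (rule measurable_L_r_history)

lemma measurable_history_translate:
  assumes "\<And>i. y i \<in> maximal_ideal"
  shows "(\<lambda>\<omega>. map (L_r r (\<lambda>i. y i + \<alpha> i \<omega>)) [0..<N]) \<in> M \<rightarrow>\<^sub>M count_space UNIV"
proof (rule measurable_L_r_history)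
  fix i assume "i \<in> {1..r}"
  then show "(\<lambda>\<omega>. y i + \<alpha> i \<omega>) \<in> borel_measurable M"
    by (rule measurable_compose[OF measurable_sample_borel borel_measurable_fls_translate])
qed

lemma prob_history_translate:
  assumes y: "\<And>i. y i \<in> maximal_ideal"
  shows "prob {\<omega>\<in>space M. P (map (L_r r (\<lambda>i. y i + \<alpha> i \<omega>)) [0..<N])} =
         prob {\<omega>\<in>space M. P (map (L_r r (sample \<omega>)) [0..<N])}"
proof -
  let ?\<Pi> = "PiM {1..r} (\<lambda>_. \<mu>)"
  have "(\<lambda>a. map (L_r r (\<lambda>i. a i)) [0..<N]) \<in> ?\<Pi> \<rightarrow>\<^sub>M count_space UNIV"
  proof (rule measurable_L_r_history)
    fix i assume "i \<in> {1..r}"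
    then have "(\<lambda>a. a i) \<in> ?\<Pi> \<rightarrow>\<^sub>M \<mu>" by (rule measurable_component_singleton)
    from measurable_compose[OF this measurable_haar_borel]
    show "(\<lambda>a. a i) \<in> borel_measurable ?\<Pi>" .
  qed
  then have S: "{a\<in>space ?\<Pi>. P (map (L_r r a) [0..<N])} \<in> sets ?\<Pi>" by measurable
  have *: "prob {\<omega>\<in>space M. P (map (L_r r (\<lambda>i. z i + \<alpha> i \<omega>)) [0..<N])} =
        measure ?\<Pi> {a\<in>space ?\<Pi>. P (map (L_r r a) [0..<N])}"
    if z: "\<And>i. z i \<in> maximal_ideal" for z
  proof -
    let ?X = "\<lambda>\<omega>. \<lambda>i\<in>{1..r}. z i + \<alpha> i \<omega>"
    have X: "?X \<in> M \<rightarrow>\<^sub>M ?\<Pi>"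
      by (rule measurable_restrict)
        (rule measurable_compose[OF measurable_sample measurable_translate_haar[OF z]])
    have cong: "L_r r (?X \<omega>) n = L_r r (\<lambda>i. z i + \<alpha> i \<omega>) n" for \<omega> n
      by (rule L_r_cong) simp
    have hist: "map (L_r r (?X \<omega>)) [0..<N] = map (L_r r (\<lambda>i. z i + \<alpha> i \<omega>)) [0..<N]" for \<omega>
      by (rule map_cong[OF refl cong])
    have "measure ?\<Pi> {a\<in>space ?\<Pi>. P (map (L_r r a) [0..<N])} =
      measure (distr M ?\<Pi> ?X) {a\<in>space ?\<Pi>. P (map (L_r r a) [0..<N])}"
      by (subst joint_law_translate[OF z]) simp
    also have "\<dots> = prob (?X -` {a\<in>space ?\<Pi>. P (map (L_r r a) [0..<N])} \<inter> space M)"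
      by (rule measure_distr[OF X S])
    also have "?X -` {a\<in>space ?\<Pi>. P (map (L_r r a) [0..<N])} \<inter> space M =
       {\<omega>\<in>space M. P (map (L_r r (\<lambda>i. z i + \<alpha> i \<omega>)) [0..<N])}"
      using measurable_space[OF X] by (intro set_eqI) (simp only: vimage_eq Int_iff mem_Collect_eq hist, blast)
    finally show ?thesis by simp
  qed
  have "(0 :: 'a fls) \<in> maximal_ideal" by (simp add: maximal_ideal_def)
  then show ?thesis using *[OF y] *[of "\<lambda>_. 0"] by simp
qed

text \<open>
  Split the event \<open>P\<close> according to the value \<open>d\<close> of \<open>L\<^sub>r(n)\<close>. On each piece, the \<open>q\<^sup>r\<close>
  perturbations of the coefficients at position \<open>n + d\<close> preserve the piece and, pointwise,
  exactly one of them suppresses the jump at \<open>n\<close>. So the piece is the disjoint union of \<open>q\<^sup>r\<close>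
  translates of its part without a jump, and all translates have the same probability.
\<close>

lemma prob_no_jump_given_history:
  "prob {\<omega>\<in>space M. P (map (L_r r (sample \<omega>)) [0..<Suc n])} =
   real CARD('a) ^ r *
     prob {\<omega>\<in>space M. P (map (L_r r (sample \<omega>)) [0..<Suc n]) \<and> J_r r (sample \<omega>) n = 0}"
proof -
  define hist where "hist a = map (L_r r a) [0..<Suc n]" for a :: "nat \<Rightarrow> 'a fls"
  define V where "V = {1..r} \<rightarrow>\<^sub>E (UNIV :: 'a set)"
  define sh where "sh d v a = (\<lambda>i. single_coeff (n + d) (v i) + a i)"
    for d and v :: "nat \<Rightarrow> 'a" and a :: "nat \<Rightarrow> 'a fls"
  define E where "E d = {\<omega>\<in>space M. P (hist (sample \<omega>)) \<and> L_r r (sample \<omega>) n = d}" for d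
  define G where "G d = {\<omega>\<in>space M. P (hist (sample \<omega>)) \<and> L_r r (sample \<omega>) n = d \<and> J_r r (sample \<omega>) n = 0}" for d
  \<comment> \<open>\<open>H d v\<close> is the preimage of \<open>G d\<close> under the perturbation by \<open>v\<close>.\<close>
  define H where "H d v = {\<omega>\<in>space M. P (hist (sh d v (sample \<omega>))) \<and>
     L_r r (sh d v (sample \<omega>)) n = d \<and> J_r r (sh d v (sample \<omega>)) n = 0}" for d v
  have V: "finite V" "card V = CARD('a) ^ r"
    by (auto simp: V_def card_PiE intro!: finite_PiE)

  \<comment> \<open>The event \<open>G d\<close> as a condition on the list \<open>L\<^sub>r(0), \<dots>, L\<^sub>r(n + 1)\<close>, the form in which
    its probability is known to be translation invariant.\<close>
  define P' where "P' d l \<longleftrightarrow> P (take (Suc n) l) \<and> l ! n = d \<and> \<not> l ! n < l ! Suc n" for d and l :: "nat list"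
  have P': "P' d (map (L_r r a) [0..<Suc (Suc n)]) \<longleftrightarrow> P (hist a) \<and> L_r r a n = d \<and> J_r r a n = 0"
    for d and a :: "nat \<Rightarrow> 'a fls"
    by (simp add: P'_def hist_def J_r_def nth_append)
  have L_pos: "L_r r a m \<ge> 1" for a :: "nat \<Rightarrow> 'a fls" and m
    by (metis L_r_witness le_add2)

  have sh_hist: "hist (sh d v a) = hist a" "L_r r (sh d v a) n = d" if "L_r r a n = d" for d v a
    using L_r_shift[of _ n r a v] that by (auto simp: hist_def sh_def)
  have sh_sh: "sh d (\<lambda>i. - v i) (sh d v a) = a" for d v a
    by (intro ext fls_eqI) (simp add: sh_def fls_nth_single_coeff)
  have L_sh: "L_r r (sh d v a) n = d \<longleftrightarrow> L_r r a n = d" for d v a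
    using sh_hist(2)[of a d v] sh_hist(2)[of "sh d v a" d "\<lambda>i. - v i"] by (auto simp: sh_sh)

  have E_eq: "E d = (\<Union>v\<in>V. H d v)" for d
  proof (intro equalityI subsetI)
    fix \<omega> assume "\<omega> \<in> E d"
    moreover from this obtain v where "v \<in> V" "J_r r (sh d v (sample \<omega>)) n = 0"
      using J_r_shift_unique[of r n "sample \<omega>"] by (auto simp: E_def V_def sh_def)
    ultimately show "\<omega> \<in> (\<Union>v\<in>V. H d v)"
      by (auto simp: E_def H_def sh_hist)
  next
    fix \<omega> assume "\<omega> \<in> (\<Union>v\<in>V. H d v)"
    then show "\<omega> \<in> E d" by (auto simp: E_def H_def sh_hist L_sh)
  qed
  have disj: "disjoint_family_on (H d) V" for d
  proof (unfold disjoint_family_on_def, intro ballI impI)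
    fix v w assume vw: "v \<in> V" "w \<in> V" "v \<noteq> w"
    show "H d v \<inter> H d w = {}"
    proof (rule ccontr)
      assume "H d v \<inter> H d w \<noteq> {}"
      then obtain \<omega> where "L_r r (sample \<omega>) n = d" "J_r r (sh d v (sample \<omega>)) n = 0" "J_r r (sh d w (sample \<omega>)) n = 0"
        by (auto simp: H_def L_sh)
      then show False
        using J_r_shift_unique[of r n "sample \<omega>"] vw unfolding V_def sh_def by blast
    qed
  qed
  have H: "H d v \<in> events" "prob (H d v) = prob (G d)" if "d \<ge> 1" for d v
  proof -
    have y: "single_coeff (n + d) (v i) \<in> maximal_ideal" for i
      using that by (intro single_coeff_in_maximal_ideal) simp
    have H_eq: "H d v = {\<omega>\<in>space M. P' d (map (L_r r (\<lambda>i. single_coeff (n + d) (v i) + \<alpha> i \<omega>)) [0..<Suc (Suc n)])}"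
      unfolding P' by (simp add: H_def sh_def)
    show "H d v \<in> events" unfolding H_eq
      using measurable_history_translate[of "\<lambda>i. single_coeff (n + d) (v i)" "Suc (Suc n)", OF y]
      by (rule measurable_sets_Collect) simp
    have "prob (H d v) = prob {\<omega>\<in>space M. P' d (map (L_r r (sample \<omega>)) [0..<Suc (Suc n)])}"
      unfolding H_eq using y by (rule prob_history_translate)
    also have "\<dots> = prob (G d)" unfolding P' by (simp add: G_def)
    finally show "prob (H d v) = prob (G d)" .
  qed
  have E_G: "prob (E d) = real CARD('a) ^ r * prob (G d)" for d
  proof (cases "d \<ge> 1")
    case True
    \<comment> \<open>Only now \<open>n + d \<ge> 1\<close> is certain, so that the perturbation stays in the maximal ideal.\<close>
    have "prob (E d) = (\<Sum>v\<in>V. prob (H d v))"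
      unfolding E_eq using V H[OF True] disj by (intro finite_measure_finite_Union) auto
    then show ?thesis using H[OF True] V by simp
  next
    case False
    then have "E d = {}" "G d = {}" using L_pos by (force simp: E_def G_def)+
    then show ?thesis by simp
  qed
  have E_ev: "E d \<in> events" for d
  proof -
    have "E d = {\<omega>\<in>space M. (\<lambda>l. P l \<and> l ! n = d) (map (L_r r (sample \<omega>)) [0..<Suc n])}"
      by (simp add: E_def hist_def nth_append)
    also have "\<dots> \<in> events"
      using measurable_history_sample by (rule measurable_sets_Collect) simp
    finally show ?thesis .
  qed
  have G_ev: "G d \<in> events" for d
  proof -
    have "G d = {\<omega>\<in>space M. P' d (map (L_r r (sample \<omega>)) [0..<Suc (Suc n)])}"
      unfolding P' by (simp add: G_def)
    also have "\<dots> \<in> events"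
      using measurable_history_sample by (rule measurable_sets_Collect) simp
    finally show ?thesis .
  qed
  have "(\<lambda>d. prob (E d)) sums prob (\<Union>d. E d)"
    using E_ev by (intro finite_measure_UNION) (auto simp: disjoint_family_on_def E_def)
  moreover have "(\<lambda>d. real CARD('a) ^ r * prob (G d)) sums (real CARD('a) ^ r * prob (\<Union>d. G d))"
    using G_ev by (intro sums_mult finite_measure_UNION) (auto simp: disjoint_family_on_def G_def)
  ultimately have "prob (\<Union>d. E d) = real CARD('a) ^ r * prob (\<Union>d. G d)"
    unfolding E_G by (rule sums_unique2)
  moreover have "(\<Union>d. E d) = {\<omega>\<in>space M. P (hist (sample \<omega>))}"
    "(\<Union>d. G d) = {\<omega>\<in>space M. P (hist (sample \<omega>)) \<and> J_r r (sample \<omega>) n = 0}"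
    by (auto simp: E_def G_def)
  ultimately show ?thesis by (simp add: hist_def)
qed

definition p :: real where "p = 1 - 1 / real CARD('a) ^ r"

lemma p_bounds: "0 < p" "p < 1"
proof -
  have "card {0, 1 :: 'a} \<le> CARD('a)" by (rule card_mono) auto
  then have "1 < real CARD('a)" by simp
  then have "1 < real CARD('a) ^ r" using r_pos by (intro one_less_power) auto
  then show "0 < p" "p < 1" by (auto simp: p_def)
qed

lemma measurable_J_r [measurable]: "(\<lambda>\<omega>. J_r r (sample \<omega>) n) \<in> M \<rightarrow>\<^sub>M count_space UNIV"
  unfolding J_r_def using measurable_L_r[of r \<alpha> M, OF measurable_sample_borel] by measurable

lemma measurable_history_pred:
  "{\<omega>\<in>space M. P (map (L_r r (sample \<omega>)) [0..<m])} \<in> events"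
  using measurable_history_sample by (rule measurable_sets_Collect) simp

lemma J_r_cases: "J_r r a n = 0 \<or> J_r r a n = 1"
  by (auto simp: J_r_def)

lemma prob_history_and_jump_eq:
  "prob {\<omega>\<in>space M. P (map (L_r r (sample \<omega>)) [0..<Suc n]) \<and> J_r r (sample \<omega>) n = 0} =
     (1 - p) * prob {\<omega>\<in>space M. P (map (L_r r (sample \<omega>)) [0..<Suc n])}" (is "prob ?Z = _ * prob ?P")
  "prob {\<omega>\<in>space M. P (map (L_r r (sample \<omega>)) [0..<Suc n]) \<and> J_r r (sample \<omega>) n = 1} =
     p * prob {\<omega>\<in>space M. P (map (L_r r (sample \<omega>)) [0..<Suc n])}" (is "prob ?O = _")
proof -
  show Z: "prob ?Z = (1 - p) * prob ?P"
    using prob_no_jump_given_history[of P n] by (simp add: p_def)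
  have [measurable]: "?P \<in> events" by (rule measurable_history_pred)
  have Zev: "?P \<inter> {\<omega>\<in>space M. J_r r (sample \<omega>) n = k} \<in> events" for k by measurable
  have "?P = ?Z \<union> ?O" using J_r_cases by auto
  then have "prob ?P = prob (?Z \<union> ?O)" by simp
  also have "\<dots> = prob ?Z + prob ?O"
    using Zev[of 0] Zev[of 1] by (intro finite_measure_Union) (auto simp: Int_def conj_ac)
  finally show "prob ?O = p * prob ?P" unfolding Z by (simp only: left_diff_distrib)
qed

lemma prob_jump: "prob {\<omega>\<in>space M. J_r r (sample \<omega>) n = 0} = 1 - p"
    "prob {\<omega>\<in>space M. J_r r (sample \<omega>) n = 1} = p"
  using prob_history_and_jump_eq[of "\<lambda>_. True" n] by (simp_all add: prob_space)

lemma prob_history_and_jump_in: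
  "prob {\<omega>\<in>space M. P (map (L_r r (sample \<omega>)) [0..<Suc n]) \<and> J_r r (sample \<omega>) n \<in> B} =
   prob {\<omega>\<in>space M. P (map (L_r r (sample \<omega>)) [0..<Suc n])} * prob {\<omega>\<in>space M. J_r r (sample \<omega>) n \<in> B}"
proof -
  consider "0 \<in> B" "1 \<in> B" | "0 \<in> B" "1 \<notin> B" | "0 \<notin> B" "1 \<in> B" | "0 \<notin> B" "1 \<notin> B" by blast
  then show ?thesis
  proof cases
    case 1
    then have "J_r r a n \<in> B" for a :: "nat \<Rightarrow> 'a fls" by (simp add: J_r_def)
    then show ?thesis by (simp add: prob_space)
  next
    case 2
    then have "J_r r a n \<in> B \<longleftrightarrow> J_r r a n = 0" for a :: "nat \<Rightarrow> 'a fls" by (simp add: J_r_def)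
    then show ?thesis by (simp only: prob_history_and_jump_eq prob_jump mult.commute)
  next
    case 3
    then have "J_r r a n \<in> B \<longleftrightarrow> J_r r a n = 1" for a :: "nat \<Rightarrow> 'a fls" by (simp add: J_r_def)
    then show ?thesis by (simp only: prob_history_and_jump_eq prob_jump mult.commute)
  next
    case 4
    then have "J_r r a n \<notin> B" for a :: "nat \<Rightarrow> 'a fls" by (simp add: J_r_def)
    then show ?thesis by simp
  qed
qed

text \<open>
  The jumps before \<open>n\<close> are a function of \<open>L\<^sub>r(0), \<dots>, L\<^sub>r(n)\<close>, so they are independent of
  the jump at \<open>n\<close>. Peeling off the largest index proves joint independence.
\<close>

theorem indep_vars_jumps:
  "indep_vars (\<lambda>_. count_space UNIV) (\<lambda>n \<omega>. J_r r (sample \<omega>) n) UNIV"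
proof -
  have fin: "prob {\<omega>\<in>space M. \<forall>i\<in>I. J_r r (sample \<omega>) i \<in> B i} =
       (\<Prod>i\<in>I. prob {\<omega>\<in>space M. J_r r (sample \<omega>) i \<in> B i})" if "finite I" for I and B :: "nat \<Rightarrow> nat set"
    using that
  proof (induction I rule: finite_linorder_max_induct)
    case empty
    then show ?case by (simp add: prob_space)
  next
    case (insert n I)
    let ?P = "\<lambda>l :: nat list. \<forall>i\<in>I. of_bool (l ! i < l ! (i + 1)) \<in> B i"
    have P: "?P (map (L_r r a) [0..<Suc n]) \<longleftrightarrow> (\<forall>i\<in>I. J_r r a i \<in> B i)" for a :: "nat \<Rightarrow> 'a fls"
    proof (rule ball_cong[OF refl])
      fix i assume "i \<in> I"
      then have "i < n" using insert by auto
      then have "map (L_r r a) [0..<Suc n] ! i = L_r r a i" "map (L_r r a) [0..<Suc n] ! (i + 1) = L_r r a (i + 1)"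
        by (simp_all del: upt_Suc)
      then show "of_bool (map (L_r r a) [0..<Suc n] ! i < map (L_r r a) [0..<Suc n] ! (i + 1)) \<in> B i
         \<longleftrightarrow> J_r r a i \<in> B i"
        by (simp only: J_r_def)
    qed
    have "prob {\<omega>\<in>space M. \<forall>i\<in>insert n I. J_r r (sample \<omega>) i \<in> B i} =
      prob {\<omega>\<in>space M. ?P (map (L_r r (sample \<omega>)) [0..<Suc n]) \<and> J_r r (sample \<omega>) n \<in> B n}"
      unfolding P by (simp add: conj_commute)
    also have "\<dots> = prob {\<omega>\<in>space M. ?P (map (L_r r (sample \<omega>)) [0..<Suc n])} * prob {\<omega>\<in>space M. J_r r (sample \<omega>) n \<in> B n}"
      by (rule prob_history_and_jump_in)
    also have "\<dots> = (\<Prod>i\<in>insert n I. prob {\<omega>\<in>space M. J_r r (sample \<omega>) i \<in> B i})"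
      unfolding P insert.IH using insert.hyps by (subst prod.insert) auto
    finally show ?case .
  qed
  show ?thesis unfolding indep_vars_def2
  proof (intro conjI ballI indep_setsI)
    fix I :: "nat set" and A
    assume I: "I \<noteq> {}" "I \<subseteq> UNIV" "finite I"
      and A: "\<forall>j\<in>I. A j \<in> {(\<lambda>\<omega>. J_r r (sample \<omega>) j) -` B \<inter> space M |B. B \<in> sets (count_space UNIV)}"
    have "\<forall>j\<in>I. \<exists>B. A j = {\<omega>\<in>space M. J_r r (sample \<omega>) j \<in> B}"
    proof
      fix j assume "j \<in> I"
      with A obtain B where "A j = (\<lambda>\<omega>. J_r r (sample \<omega>) j) -` B \<inter> space M" by blast
      then have "A j = {\<omega>\<in>space M. J_r r (sample \<omega>) j \<in> B}" by auto
      then show "\<exists>B. A j = {\<omega>\<in>space M. J_r r (sample \<omega>) j \<in> B}" ..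
    qed
    then obtain B where B: "\<And>j. j \<in> I \<Longrightarrow> A j = {\<omega>\<in>space M. J_r r (sample \<omega>) j \<in> B j}"
      by metis
    then have "(\<Inter>j\<in>I. A j) = {\<omega>\<in>space M. \<forall>j\<in>I. J_r r (sample \<omega>) j \<in> B j}" using I(1) by auto
    then show "prob (\<Inter>j\<in>I. A j) = (\<Prod>j\<in>I. prob (A j))" using fin[OF I(3)] B by simp
  qed (auto intro: measurable_sets[OF measurable_J_r])
qed

lemma sum_J_r_eq_history:
  "(\<Sum>i<n. J_r r a i) = (\<lambda>l. \<Sum>i<n. of_bool (l ! i < l ! (i + 1))) (map (L_r r a) [0..<Suc n])"
  by (intro sum.cong) (simp_all add: J_r_def del: upt_Suc)

lemma prob_sum_J_r:
  "prob {\<omega>\<in>space M. (\<Sum>i<N. J_r r (sample \<omega>) i) = k} = real (N choose k) * p ^ k * (1 - p) ^ (N - k)"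
proof (induction N arbitrary: k)
  case 0
  then show ?case by (cases k) (auto simp: prob_space)
next
  case (Suc N)
  let ?S = "\<lambda>\<omega>. \<Sum>i<N. J_r r (sample \<omega>) i"
  have step: "prob {\<omega>\<in>space M. ?S \<omega> = k \<and> J_r r (sample \<omega>) N = 0} = (1 - p) * prob {\<omega>\<in>space M. ?S \<omega> = k}"
    "prob {\<omega>\<in>space M. ?S \<omega> = k \<and> J_r r (sample \<omega>) N = 1} = p * prob {\<omega>\<in>space M. ?S \<omega> = k}" for k
    unfolding sum_J_r_eq_history by (rule prob_history_and_jump_eq)+
  show ?case
  proof (cases k)
    case 0
    have "prob {\<omega>\<in>space M. (\<Sum>i<Suc N. J_r r (sample \<omega>) i) = k} =
       prob {\<omega>\<in>space M. ?S \<omega> = 0 \<and> J_r r (sample \<omega>) N = 0}"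
      by (simp add: 0 del: sum_eq_0_iff)
    then show ?thesis using 0 by (simp only: step Suc) simp
  next
    case (Suc j)
    have "{\<omega>\<in>space M. (\<Sum>i<Suc N. J_r r (sample \<omega>) i) = k} =
       {\<omega>\<in>space M. ?S \<omega> = Suc j \<and> J_r r (sample \<omega>) N = 0} \<union> {\<omega>\<in>space M. ?S \<omega> = j \<and> J_r r (sample \<omega>) N = 1}"
    proof (rule set_eqI)
      fix \<omega>
      show "\<omega> \<in> {\<omega>\<in>space M. (\<Sum>i<Suc N. J_r r (sample \<omega>) i) = k} \<longleftrightarrow> \<omega> \<in>
       {\<omega>\<in>space M. ?S \<omega> = Suc j \<and> J_r r (sample \<omega>) N = 0} \<union> {\<omega>\<in>space M. ?S \<omega> = j \<and> J_r r (sample \<omega>) N = 1}"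
        using J_r_cases[of "sample \<omega>" N] Suc by auto
    qed
    then have "prob {\<omega>\<in>space M. (\<Sum>i<Suc N. J_r r (sample \<omega>) i) = k} =
       prob {\<omega>\<in>space M. ?S \<omega> = Suc j \<and> J_r r (sample \<omega>) N = 0} + prob {\<omega>\<in>space M. ?S \<omega> = j \<and> J_r r (sample \<omega>) N = 1}"
      by (simp only:, subst finite_measure_Union) auto
    also have "\<dots> = (1 - p) * (real (N choose Suc j) * p ^ Suc j * (1 - p) ^ (N - Suc j)) +
       p * (real (N choose j) * p ^ j * (1 - p) ^ (N - j))"
      by (simp only: step Suc.IH)
    also have "\<dots> = real (Suc N choose k) * p ^ k * (1 - p) ^ (Suc N - k)"
    proof (cases "j < N")
      case True
      then have "N - j = Suc (N - Suc j)" by simp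
      then show ?thesis by (simp add: Suc algebra_simps)
    next
      case False
      then show ?thesis by (simp add: Suc binomial_eq_0)
    qed
    finally show ?thesis .
  qed
qed

theorem distr_sum_J_r:
  "distr M (count_space UNIV) (\<lambda>\<omega>. \<Sum>i<N. J_r r (sample \<omega>) i) = measure_pmf (binomial_pmf N p)"
proof (rule measure_eqI_countable[of _ UNIV])
  fix k :: nat
  have "emeasure (distr M (count_space UNIV) (\<lambda>\<omega>. \<Sum>i<N. J_r r (sample \<omega>) i)) {k} =
    emeasure M {\<omega>\<in>space M. (\<Sum>i<N. J_r r (sample \<omega>) i) = k}"
    by (subst emeasure_distr) (auto intro!: arg_cong[where f = "emeasure M"])
  also have "\<dots> = ennreal (pmf (binomial_pmf N p) k)"
    using p_bounds by (simp add: emeasure_eq_measure prob_sum_J_r)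
  finally show "emeasure (distr M (count_space UNIV) (\<lambda>\<omega>. \<Sum>i<N. J_r r (sample \<omega>) i)) {k} =
    emeasure (measure_pmf (binomial_pmf N p)) {k}" by (simp add: emeasure_pmf_single)
qed auto

end

section \<open>Sums of bounded independent variables: the exponential maximal inequality\<close>

text \<open>
  The second Borel--Cantelli lemma. From any index on, the probability that no event occurs
  is a product of factors \<open>1 - q\<^sub>k \<le> exp (- q\<^sub>k)\<close>, which tends to zero.
\<close>

lemma (in prob_space) borel_cantelli_indep_vars:
  assumes indep: "indep_vars N Y (UNIV :: nat set)"
    and B: "\<And>k. B k \<in> sets (N k)"
    and div: "\<not> summable (\<lambda>k. prob (Y k -` B k \<inter> space M))"
  shows "AE \<omega> in M. \<exists>\<^sub>F k in sequentially. Y k \<omega> \<in> B k"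
proof -
  define q where "q k = prob (Y k -` B k \<inter> space M)" for k
  have Y: "Y k \<in> M \<rightarrow>\<^sub>M N k" for k using indep by (simp add: indep_vars_def)
  have "AE \<omega> in M. \<not> (\<forall>k\<ge>K. Y k \<omega> \<notin> B k)" for K
  proof -
    define F where "F = {\<omega>\<in>space M. \<forall>k\<ge>K. Y k \<omega> \<notin> B k}"
    have ev [measurable]: "{\<omega>\<in>space M. Y k \<omega> \<in> B k} \<in> events" for k
      using measurable_sets[OF Y B[of k]] by (simp add: vimage_def Int_def conj_commute)
    have F_ev: "F \<in> events" unfolding F_def by measurable
    have bound: "prob F \<le> exp (- (\<Sum>k<n. q (k + K)))" for n
    proof -
      let ?C = "\<lambda>k. Y k -` (space (N k) - B k) \<inter> space M"
      have "prob F \<le> prob (\<Inter>k\<in>{K..K+n}. ?C k)"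
      proof (rule finite_measure_mono)
        show "F \<subseteq> (\<Inter>k\<in>{K..K+n}. ?C k)"
          using measurable_space[OF Y] by (auto simp: F_def)
        show "(\<Inter>k\<in>{K..K+n}. ?C k) \<in> events"
          using B measurable_sets[OF Y] by (intro sets.finite_INT) auto
      qed
      also have "\<dots> = (\<Prod>k\<in>{K..K+n}. prob (?C k))"
        using B by (intro indep_varsD[OF indep]) auto
      also have "\<dots> = (\<Prod>k\<in>{K..K+n}. 1 - q k)"
      proof (rule prod.cong[OF refl])
        fix k
        have "?C k = space M - (Y k -` B k \<inter> space M)" using measurable_space[OF Y] by auto
        then show "prob (?C k) = 1 - q k"
          using measurable_sets[OF Y B[of k]] by (simp add: q_def prob_compl)
      qed
      also have "\<dots> \<le> (\<Prod>k\<in>{K..K+n}. exp (- q k))"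
        using exp_ge_add_one_self[of "- q _"] by (intro prod_mono) (auto simp: q_def)
      also have "\<dots> = exp (- (\<Sum>k\<in>{K..K+n}. q k))"
        by (simp add: exp_sum sum_negf flip: sum_negf)
      also have "\<dots> \<le> exp (- (\<Sum>k<n. q (k + K)))"
      proof -
        have "(\<Sum>k<n. q (k + K)) = (\<Sum>k\<in>{K..<K+n}. q k)"
          by (rule sum.reindex_bij_witness[of _ "\<lambda>k. k - K" "\<lambda>k. k + K"]) auto
        also have "\<dots> \<le> (\<Sum>k\<in>{K..K+n}. q k)" by (rule sum_mono2) (auto simp: q_def)
        finally show ?thesis by simp
      qed
      finally show ?thesis .
    qed
    have "prob F = 0"
    proof (rule ccontr)
      assume "prob F \<noteq> 0"
      then have pos: "prob F > 0" by (simp add: less_le)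
      have "(\<Sum>k<n. q (k + K)) \<le> - ln (prob F)" for n
        using ln_le_cancel_iff[OF pos, of "exp (- (\<Sum>k<n. q (k + K)))"] bound[of n] by simp
      then have "summable (\<lambda>k. q (k + K))"
        by (intro summableI_nonneg_bounded) (auto simp: q_def)
      then have "summable q" by (simp only: summable_iff_shift)
      then show False using div unfolding q_def by simp
    qed
    then show ?thesis
      by (intro AE_I[of _ _ F]) (use F_ev in \<open>auto simp: F_def emeasure_eq_measure\<close>)
  qed
  then have "AE \<omega> in M. \<forall>K. \<not> (\<forall>k\<ge>K. Y k \<omega> \<notin> B k)" by (simp add: AE_all_countable)
  then show ?thesis by (rule AE_mp) (auto simp: frequently_sequentially)
qed

lemma exp_le_quadratic:
  fixes \<delta> :: real
  assumes "\<delta> > 0"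
  obtains \<eta> where "\<eta> > 0" "\<And>x. \<bar>x\<bar> \<le> \<eta> \<Longrightarrow> exp x \<le> 1 + x + (1 + \<delta>) * x\<^sup>2 / 2"
proof -
  have "((\<lambda>x::real. (exp x - 1 - x) / x\<^sup>2) \<longlongrightarrow> 1 / 2) (at 0)" by real_asymp
  then have "\<forall>\<^sub>F x in at 0. (exp x - 1 - x) / x\<^sup>2 < (1 + \<delta>) / 2"
    by (rule order_tendstoD) (use assms in simp)
  then obtain d where d: "d > 0" "\<And>x. x \<noteq> 0 \<Longrightarrow> \<bar>x\<bar> < d \<Longrightarrow> (exp x - 1 - x) / x\<^sup>2 < (1 + \<delta>) / 2"
    by (auto simp: eventually_at dist_real_def)
  show ?thesis
  proof (rule that[of "d / 2"])
    fix x :: real assume "\<bar>x\<bar> \<le> d / 2"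
    then show "exp x \<le> 1 + x + (1 + \<delta>) * x\<^sup>2 / 2"
      using d(1) d(2)[of x] by (cases "x = 0") (auto simp: field_simps)
  qed (use d in simp)
qed

text \<open>
  Boundedness gives exponential moments at no cost; the common law \<open>D\<close> and the bound \<open>K\<close> are
  parameters so that the reflection \<open>- X\<close> is an instance again.
\<close>

locale bounded_iid = prob_space M
  for M :: "'a measure" and X :: "nat \<Rightarrow> 'a \<Rightarrow> real" and D :: "real measure" and \<sigma> K :: real +
  assumes indep: "indep_vars (\<lambda>_. borel) X UNIV"
    and law: "\<And>n. distr M borel (X n) = D"
    and mean: "\<And>n. expectation (X n) = 0"
    and variance: "\<And>n. variance (X n) = \<sigma>\<^sup>2"
    and \<sigma>_pos: "\<sigma> > 0"
    and bounded: "\<And>n \<omega>. \<omega> \<in> space M \<Longrightarrow> \<bar>X n \<omega>\<bar> \<le> K"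
begin

definition S :: "nat \<Rightarrow> 'a \<Rightarrow> real" where "S n \<omega> = (\<Sum>i<n. X i \<omega>)"

lemma measurable_X [measurable]: "X n \<in> borel_measurable M"
  using indep by (simp add: indep_vars_def)

lemma measurable_S [measurable]: "S n \<in> borel_measurable M"
  unfolding S_def[abs_def] by measurable

lemma integrable_of_bounded:
  fixes f :: "'a \<Rightarrow> real"
  assumes "f \<in> borel_measurable M" "\<And>\<omega>. \<omega> \<in> space M \<Longrightarrow> \<bar>f \<omega>\<bar> \<le> C"
  shows "integrable M f"
  using assms by (intro integrable_const_bound[of _ C]) auto

lemma second_moment: "expectation (\<lambda>\<omega>. (X n \<omega>)\<^sup>2) = \<sigma>\<^sup>2"
  using variance[of n] mean[of n] by simp

lemma integrable_X: "integrable M (X n)"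
  using bounded by (intro integrable_of_bounded) auto

lemma integrable_X_square: "integrable M (\<lambda>\<omega>. (X n \<omega>)\<^sup>2)"
proof (rule integrable_of_bounded[of _ "K\<^sup>2"])
  fix \<omega> assume "\<omega> \<in> space M"
  from power_mono[OF bounded[OF this, of n], of 2] show "\<bar>(X n \<omega>)\<^sup>2\<bar> \<le> K\<^sup>2" by simp
qed simp

lemma integrable_exp_X:
  assumes "l \<ge> 0"
  shows "integrable M (\<lambda>\<omega>. exp (l * X n \<omega>))"
proof (rule integrable_of_bounded[of _ "exp (l * K)"])
  fix \<omega> assume "\<omega> \<in> space M"
  from bounded[OF this, of n] assms have "l * X n \<omega> \<le> l * K" by (intro mult_left_mono) auto
  then show "\<bar>exp (l * X n \<omega>)\<bar> \<le> exp (l * K)" by simp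
qed simp

text \<open>
  The factor \<open>1 + \<delta>\<close> is what keeps the constant \<open>1\<close> in the law of the iterated logarithm
  sharp: a bound with a fixed worse factor, such as the one of Hoeffding, would lose it.
\<close>

lemma mgf_le:
  assumes "\<delta> > 0"
  obtains l\<^sub>0 where "l\<^sub>0 > 0"
    "\<And>l n. 0 \<le> l \<Longrightarrow> l \<le> l\<^sub>0 \<Longrightarrow> expectation (\<lambda>\<omega>. exp (l * X n \<omega>)) \<le> exp ((1 + \<delta>) * l\<^sup>2 * \<sigma>\<^sup>2 / 2)"
proof -
  obtain \<eta> where \<eta>: "\<eta> > 0" "\<And>x. \<bar>x\<bar> \<le> \<eta> \<Longrightarrow> exp x \<le> 1 + x + (1 + \<delta>) * x\<^sup>2 / 2"
    using exp_le_quadratic[OF assms] by blast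
  define l\<^sub>0 where "l\<^sub>0 = \<eta> / (\<bar>K\<bar> + 1)"
  show ?thesis
  proof (rule that[of l\<^sub>0])
    show "l\<^sub>0 > 0" using \<eta>(1) by (simp add: l\<^sub>0_def)
    fix l n assume l: "0 \<le> l" "l \<le> l\<^sub>0"
    have small: "\<bar>l * X n \<omega>\<bar> \<le> \<eta>" if "\<omega> \<in> space M" for \<omega>
    proof -
      have "\<bar>l * X n \<omega>\<bar> = l * \<bar>X n \<omega>\<bar>" using l by (simp add: abs_mult)
      also have "\<dots> \<le> l\<^sub>0 * (\<bar>K\<bar> + 1)"
        using l bounded[OF that, of n] by (intro mult_mono) auto
      also have "\<dots> = \<eta>" by (simp add: l\<^sub>0_def)
      finally show ?thesis .
    qed
    have "expectation (\<lambda>\<omega>. exp (l * X n \<omega>)) \<le>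
      expectation (\<lambda>\<omega>. 1 + l * X n \<omega> + (1 + \<delta>) * l\<^sup>2 / 2 * (X n \<omega>)\<^sup>2)"
    proof (rule integral_mono)
      show "integrable M (\<lambda>\<omega>. exp (l * X n \<omega>))" using l by (intro integrable_exp_X)
      show "integrable M (\<lambda>\<omega>. 1 + l * X n \<omega> + (1 + \<delta>) * l\<^sup>2 / 2 * (X n \<omega>)\<^sup>2)"
        using integrable_X integrable_X_square by simp
      fix \<omega> assume "\<omega> \<in> space M"
      from \<eta>(2)[OF small[OF this]]
      show "exp (l * X n \<omega>) \<le> 1 + l * X n \<omega> + (1 + \<delta>) * l\<^sup>2 / 2 * (X n \<omega>)\<^sup>2"
        by (simp add: power_mult_distrib)
    qed
    also have "\<dots> = 1 + (1 + \<delta>) * l\<^sup>2 * \<sigma>\<^sup>2 / 2"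
      using integrable_X[of n] integrable_X_square[of n]
      by (simp add: prob_space mean second_moment)
    also have "\<dots> \<le> exp ((1 + \<delta>) * l\<^sup>2 * \<sigma>\<^sup>2 / 2)" by (rule exp_ge_add_one_self)
    finally show "expectation (\<lambda>\<omega>. exp (l * X n \<omega>)) \<le> exp ((1 + \<delta>) * l\<^sup>2 * \<sigma>\<^sup>2 / 2)" .
  qed
qed

lemma expectation_past_mult_next:
  assumes g: "g \<in> borel_measurable (PiM {..<n} (\<lambda>_. borel))"
    and h: "h \<in> borel_measurable borel"
    and int: "integrable M (\<lambda>\<omega>. g (\<lambda>i\<in>{..<n}. X i \<omega>))" "integrable M (\<lambda>\<omega>. h (X n \<omega>))"
  shows "integrable M (\<lambda>\<omega>. g (\<lambda>i\<in>{..<n}. X i \<omega>) * h (X n \<omega>))"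
    and "expectation (\<lambda>\<omega>. g (\<lambda>i\<in>{..<n}. X i \<omega>) * h (X n \<omega>)) =
         expectation (\<lambda>\<omega>. g (\<lambda>i\<in>{..<n}. X i \<omega>)) * expectation (\<lambda>\<omega>. h (X n \<omega>) :: real)"
proof -
  have "indep_var (PiM {..<n} (\<lambda>_. borel)) (\<lambda>\<omega>. \<lambda>i\<in>{..<n}. X i \<omega>) (PiM {n} (\<lambda>_. borel)) (\<lambda>\<omega>. \<lambda>i\<in>{n}. X i \<omega>)"
    by (rule indep_var_restrict[OF indep]) auto
  moreover have "(\<lambda>x. h (x n)) \<in> borel_measurable (PiM {n} (\<lambda>_. borel))"
    using measurable_component_singleton[of n "{n}" "\<lambda>_. borel"] h by (rule measurable_compose) simp
  ultimately have "indep_var borel (g \<circ> (\<lambda>\<omega>. \<lambda>i\<in>{..<n}. X i \<omega>)) borel ((\<lambda>x. h (x n)) \<circ> (\<lambda>\<omega>. \<lambda>i\<in>{n}. X i \<omega>))"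
    using g by (intro indep_var_compose)
  then have "indep_var borel (\<lambda>\<omega>. g (\<lambda>i\<in>{..<n}. X i \<omega>)) borel (\<lambda>\<omega>. h (X n \<omega>))"
    by (simp add: comp_def)
  from indep_var_integrable[OF this int] indep_var_lebesgue_integral[OF this int]
  show "integrable M (\<lambda>\<omega>. g (\<lambda>i\<in>{..<n}. X i \<omega>) * h (X n \<omega>))"
    and "expectation (\<lambda>\<omega>. g (\<lambda>i\<in>{..<n}. X i \<omega>) * h (X n \<omega>)) =
         expectation (\<lambda>\<omega>. g (\<lambda>i\<in>{..<n}. X i \<omega>)) * expectation (\<lambda>\<omega>. h (X n \<omega>) :: real)" .
qed

text \<open>
  This is Ville's inequality for the supermartingale \<open>exp (l S\<^sub>n - n c)\<close>. Its proof stops the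
  process at the first time it reaches \<open>exp a\<close>: \<open>W n\<close> is the process before that time, \<open>A n\<close>
  the event that the level has been reached by time \<open>n\<close>, and the invariant
  \<open>E W\<^sub>n + e\<^sup>a P(A\<^sub>n) \<le> 1\<close> says that what leaves \<open>W\<close> pays for the growth of \<open>A\<close>.
\<close>

lemma maximal_inequality:
  assumes l: "l \<ge> 0" and mgf: "\<And>n. expectation (\<lambda>\<omega>. exp (l * X n \<omega>)) \<le> exp c"
  shows "prob {\<omega>\<in>space M. \<exists>k\<le>n. l * S k \<omega> - real k * c \<ge> a} \<le> exp (- a)"
proof -
  define A where "A n = {\<omega>\<in>space M. \<exists>k\<le>n. l * S k \<omega> - real k * c \<ge> a}" for n
  define w where "w n x = (if \<forall>k\<le>n. l * (\<Sum>i<k. x i) - real k * c < a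
      then exp (l * (\<Sum>i<n. x i) - real n * c) else 0)" for n and x :: "nat \<Rightarrow> real"
  define W where "W n \<omega> = (if \<forall>k\<le>n. l * S k \<omega> - real k * c < a
      then exp (l * S n \<omega> - real n * c) else 0)" for n \<omega>
  have w_W: "w n (\<lambda>i\<in>{..<n}. X i \<omega>) = W n \<omega>" for n \<omega>
  proof -
    have "(\<Sum>i<k. (\<lambda>i\<in>{..<n}. X i \<omega>) i) = S k \<omega>" if "k \<le> n" for k
      unfolding S_def using that by (intro sum.cong) auto
    then show ?thesis by (simp add: w_def W_def cong: all_cong1 imp_cong)
  qed
  have w_meas: "w n \<in> borel_measurable (PiM {..<n} (\<lambda>_. borel))" for n
  proof -
    have sums: "(\<lambda>x. \<Sum>i<k. x i :: real) \<in> borel_measurable (PiM {..<n} (\<lambda>_. borel))" if "k \<le> n" for k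
      using that by (intro borel_measurable_sum measurable_component_singleton) auto
    have "Measurable.pred (PiM {..<n} (\<lambda>_. borel)) (\<lambda>x. \<forall>k\<in>{..n}. l * (\<Sum>i<k. x i) - real k * c < a)"
    proof (rule pred_intros_finite(3))
      fix k assume "k \<in> {..n}"
      then have [measurable]: "(\<lambda>x. \<Sum>i<k. x i :: real) \<in> borel_measurable (PiM {..<n} (\<lambda>_. borel))"
        by (intro sums) simp
      show "Measurable.pred (PiM {..<n} (\<lambda>_. borel)) (\<lambda>x. l * (\<Sum>i<k. x i) - real k * c < a)"
        by measurable
    qed simp
    then have [measurable]: "Measurable.pred (PiM {..<n} (\<lambda>_. borel)) (\<lambda>x. \<forall>k\<le>n. l * (\<Sum>i<k. x i) - real k * c < a)"
      by (simp add: Ball_def)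
    note [measurable] = sums[OF order.refl]
    show ?thesis unfolding w_def[abs_def] by measurable
  qed
  have W_meas [measurable]: "W n \<in> borel_measurable M" for n
    unfolding W_def[abs_def] by measurable
  have A_ev [measurable]: "A n \<in> events" for n
    unfolding A_def by measurable
  have W_int: "integrable M (W n)" for n
    by (rule integrable_of_bounded[of _ "exp a"]) (auto simp: W_def less_imp_le)
  have W_nonneg: "W n \<omega> \<ge> 0" for n \<omega> by (simp add: W_def)
  have "expectation (W n) + exp a * prob (A n) \<le> 1"
  proof (induction n)
    case 0
    show ?case
    proof (cases "a \<le> 0")
      case True
      then have "W 0 = (\<lambda>_. 0)" by (auto simp: W_def S_def)
      moreover have "exp a * prob (A 0) \<le> 1 * 1" using True by (intro mult_mono) auto
      ultimately show ?thesis by simp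
    next
      case False
      then have "W 0 = (\<lambda>_. 1)" "A 0 = {}" by (auto simp: W_def A_def S_def)
      then show ?thesis by (simp add: prob_space)
    qed
  next
    case (Suc n)
    let ?B = "A (Suc n) - A n"
    note past = expectation_past_mult_next[OF w_meas, of "\<lambda>x. exp (l * x)" n, unfolded w_W, OF _ W_int integrable_exp_X[OF l]]
    have int: "integrable M (\<lambda>\<omega>. W n \<omega> * exp (l * X n \<omega>) * exp (- c))"
      using past(1) by simp
    have "expectation (W (Suc n)) + exp a * prob ?B = expectation (\<lambda>\<omega>. W (Suc n) \<omega> + exp a * indicator ?B \<omega>)"
      using W_int by (subst Bochner_Integration.integral_add) (auto simp: emeasure_eq_measure)
    also have "\<dots> \<le> expectation (\<lambda>\<omega>. W n \<omega> * exp (l * X n \<omega>) * exp (- c))"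
    proof (rule integral_mono)
      show "integrable M (\<lambda>\<omega>. W (Suc n) \<omega> + exp a * indicator ?B \<omega>)"
        using W_int by (auto simp: emeasure_eq_measure)
      show "integrable M (\<lambda>\<omega>. W n \<omega> * exp (l * X n \<omega>) * exp (- c))" by fact
      fix \<omega> assume \<omega>: "\<omega> \<in> space M"
      have S_Suc: "l * S (Suc n) \<omega> - real (Suc n) * c = (l * S n \<omega> - real n * c) + l * X n \<omega> - c"
        by (simp add: S_def algebra_simps)
      show "W (Suc n) \<omega> + exp a * indicator ?B \<omega> \<le> W n \<omega> * exp (l * X n \<omega>) * exp (- c)"
      proof (cases "\<omega> \<in> A n")
        case True
        then have "W (Suc n) \<omega> = 0" "\<omega> \<notin> ?B"
          unfolding A_def W_def by (auto simp: not_less) (metis le_SucI not_less)+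
        then show ?thesis by (simp add: W_nonneg)
      next
        case False
        then have lt: "\<forall>k\<le>n. l * S k \<omega> - real k * c < a"
          using \<omega> unfolding A_def mem_Collect_eq by (meson not_le)
        then have eq: "W n \<omega> * exp (l * X n \<omega>) * exp (- c) = exp (l * S (Suc n) \<omega> - real (Suc n) * c)"
          unfolding S_Suc by (simp add: W_def exp_add exp_diff exp_minus field_simps)
        show ?thesis
        proof (cases "l * S (Suc n) \<omega> - real (Suc n) * c < a")
          case True
          then have "\<omega> \<notin> A (Suc n)"
            using lt unfolding A_def mem_Collect_eq by (metis le_Suc_eq not_le)
          moreover have "W (Suc n) \<omega> = exp (l * S (Suc n) \<omega> - real (Suc n) * c)"
            using lt True unfolding W_def by (metis le_Suc_eq)
          ultimately show ?thesis by (simp add: eq)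
        next
          case False
          then have "W (Suc n) \<omega> = 0" unfolding W_def by (metis order.refl)
          moreover have "exp a * indicator ?B \<omega> \<le> exp a" by (simp add: indicator_def)
          moreover have "exp a \<le> exp (l * S (Suc n) \<omega> - real (Suc n) * c)" using False by simp
          ultimately show ?thesis by (simp only: eq)
        qed
      qed
    qed
    also have "\<dots> = expectation (W n) * (expectation (\<lambda>\<omega>. exp (l * X n \<omega>)) * exp (- c))"
      using past(2) by simp
    also have "\<dots> \<le> expectation (W n) * (exp c * exp (- c))"
      using mgf[of n] W_nonneg by (intro mult_left_mono mult_right_mono integral_nonneg) auto
    also have "\<dots> = expectation (W n)" by (simp add: exp_minus)
    finally have "expectation (W (Suc n)) + exp a * prob ?B \<le> expectation (W n)" .
    moreover have "prob (A (Suc n)) = prob (A n) + prob ?B"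
    proof -
      have "A n \<subseteq> A (Suc n)" by (auto simp: A_def intro: le_SucI)
      then show ?thesis by (simp add: finite_measure_Diff)
    qed
    ultimately show ?case using Suc by (simp add: distrib_left)
  qed
  moreover have "expectation (W n) \<ge> 0" using W_nonneg by simp
  ultimately have "exp a * prob (A n) \<le> 1" by linarith
  then show ?thesis unfolding A_def by (simp add: exp_minus field_simps)
qed

end

section \<open>The upper half of the law of the iterated logarithm\<close>

definition iterated_log_scale :: "real \<Rightarrow> real \<Rightarrow> real" where
  "iterated_log_scale v x = sqrt (2 * x * v * ln (ln x))"

lemma ln_ln_nonneg: "x \<ge> 3 \<Longrightarrow> ln (ln x) \<ge> (0 :: real)"
proof -
  assume "x \<ge> 3"
  then have "exp 1 \<le> x" using exp_le by linarith
  then have "1 \<le> ln x" using \<open>x \<ge> 3\<close> by (subst ln_ge_iff) auto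
  then show ?thesis by simp
qed

lemma ln_ln_mono: "3 \<le> x \<Longrightarrow> x \<le> y \<Longrightarrow> ln (ln x) \<le> ln (ln y :: real)"
proof -
  assume xy: "3 \<le> x" "x \<le> y"
  then have "0 < ln x" "0 < ln y" by (auto intro: ln_gt_zero)
  with xy show ?thesis by simp
qed

lemma iterated_log_scale_mono:
  assumes "v \<ge> 0" "3 \<le> x" "x \<le> y"
  shows "iterated_log_scale v x \<le> iterated_log_scale v y"
  unfolding iterated_log_scale_def
  using assms ln_ln_nonneg[of x] ln_ln_mono[of x y]
  by (intro real_sqrt_le_mono mult_mono) auto

lemma ex_power_between:
  fixes \<theta> x :: real
  assumes "\<theta> > 1" "x \<ge> 1"
  obtains k where "\<theta> ^ k \<le> x" "x < \<theta> ^ Suc k"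
proof -
  have ex: "\<exists>n. x < \<theta> ^ n" using real_arch_pow[OF assms(1)] .
  define n where "n = (LEAST n. x < \<theta> ^ n)"
  have n: "x < \<theta> ^ n" using LeastI_ex[OF ex] by (simp add: n_def)
  then obtain k where k: "n = Suc k" using assms(2) by (cases n) auto
  have "\<not> x < \<theta> ^ k" using not_less_Least[of k "\<lambda>n. x < \<theta> ^ n"] k by (simp add: n_def)
  with n k show ?thesis by (intro that[of k]) (simp_all add: not_less)
qed

context bounded_iid begin

text \<open>
  Time is cut into blocks \<open>[\<theta>\<^sup>k, \<theta>\<^sup>k\<^sup>+\<^sup>1]\<close> with \<open>\<theta>\<close> close to \<open>1\<close>. In each block the maximal
  inequality, with the exponent \<open>l k\<close> that is optimal at the scale \<open>\<theta>\<^sup>k\<close>, bounds the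
  probability of an excess by \<open>exp (- (1 + \<epsilon>) ln ln \<theta>\<^sup>k)\<close>, a constant times
  \<open>k\<close> to the power \<open>-(1 + \<epsilon>)\<close>. This is summable, so the Borel--Cantelli lemma applies.
\<close>

theorem eventually_less_iterated_log_scale:
  assumes "\<epsilon> > 0"
  shows "AE \<omega> in M. \<forall>\<^sub>F n in sequentially. S n \<omega> < (1 + \<epsilon>) * iterated_log_scale (\<sigma>\<^sup>2) (real n)"
proof -
  \<comment> \<open>chosen such that \<open>(1 + \<delta>)\<^sup>2 \<le> 1 + \<epsilon>\<close>\<close>
  define \<delta> where "\<delta> = min \<epsilon> 1 / 3"
  define \<theta> where "\<theta> = 1 + \<delta>"
  have \<delta>: "\<delta> > 0" and \<theta>: "\<theta> > 1" using assms by (auto simp: \<delta>_def \<theta>_def)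
  have \<theta>\<delta>: "\<theta> * (1 + \<delta>) \<le> 1 + \<epsilon>"
  proof -
    have "\<delta> * \<delta> \<le> \<delta> * 1" using \<delta> by (intro mult_left_mono) (auto simp: \<delta>_def)
    moreover have "3 * \<delta> \<le> \<epsilon>" by (simp add: \<delta>_def)
    ultimately show ?thesis by (simp add: \<theta>_def algebra_simps)
  qed
  obtain l\<^sub>0 where l\<^sub>0: "l\<^sub>0 > 0"
    "\<And>l n. 0 \<le> l \<Longrightarrow> l \<le> l\<^sub>0 \<Longrightarrow> expectation (\<lambda>\<omega>. exp (l * X n \<omega>)) \<le> exp ((1 + \<delta>) * l\<^sup>2 * \<sigma>\<^sup>2 / 2)"
    using mgf_le[OF \<delta>] by blast
  define L where "L = ln \<theta>"
  have L: "L > 0" using \<theta> by (simp add: L_def)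
  define LL where "LL k = ln (ln (\<theta> ^ k))" for k
  have LL: "LL k = ln (real k * L)" for k using \<theta> by (simp add: LL_def L_def ln_realpow)
  define l where "l k = sqrt (2 * LL k / (\<sigma>\<^sup>2 * \<theta> ^ k))" for k
  define c where "c k = (1 + \<delta>) * (l k)\<^sup>2 * \<sigma>\<^sup>2 / 2" for k
  \<comment> \<open>If the claimed bound fails at some \<open>n\<close> between \<open>\<theta> ^ k\<close> and \<open>\<theta> ^ Suc k\<close>, then \<open>B k\<close> occurs, provided \<open>k\<close> is large.\<close>
  define B where "B k = {\<omega>\<in>space M. \<exists>n \<le> nat \<lfloor>\<theta> ^ Suc k\<rfloor>. l k * S n \<omega> - real n * c k \<ge> (1 + \<epsilon>) * LL k}" for k
  have B_ev [measurable]: "B k \<in> events" for k unfolding B_def by measurable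
  have "l \<longlonglongrightarrow> 0"
  proof -
    have "(\<lambda>k. sqrt (2 * ln (real k * L) / (\<sigma>\<^sup>2 * exp (real k * L)))) \<longlonglongrightarrow> 0"
      using L \<sigma>_pos by real_asymp
    moreover have "exp (real k * L) = \<theta> ^ k" for k
      using \<theta> by (simp add: L_def exp_of_nat_mult)
    ultimately show ?thesis by (simp add: l_def[abs_def] LL)
  qed
  then have "\<forall>\<^sub>F k in sequentially. l k < l\<^sub>0" using l\<^sub>0(1) by (rule order_tendstoD)
  moreover have "\<forall>\<^sub>F k in sequentially. \<theta> ^ k \<ge> 3"
  proof -
    obtain N where N: "3 < \<theta> ^ N" using real_arch_pow[OF \<theta>] by blast
    have "3 \<le> \<theta> ^ k" if "k \<ge> N" for k
      using N power_increasing[OF that, of \<theta>] \<theta> by linarith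
    then show ?thesis by (rule eventually_sequentiallyI)
  qed
  moreover have "\<forall>\<^sub>F k::nat in sequentially. k > 0" by (rule eventually_gt_at_top)
  ultimately have good: "\<forall>\<^sub>F k in sequentially. l k < l\<^sub>0 \<and> \<theta> ^ k \<ge> 3 \<and> k > 0"
    by eventually_elim simp
  have B_prob: "prob (B k) \<le> L powr - (1 + \<epsilon>) * real k powr - (1 + \<epsilon>)"
    if k: "l k < l\<^sub>0" "\<theta> ^ k \<ge> 3" "k > 0" for k
  proof -
    have "LL k \<ge> 0" using ln_ln_nonneg[OF k(2)] by (simp add: LL_def)
    then have "l k \<ge> 0" using \<theta> by (simp add: l_def)
    have "prob (B k) \<le> exp (- ((1 + \<epsilon>) * LL k))"
      unfolding B_def
      by (rule maximal_inequality[OF \<open>l k \<ge> 0\<close>]) (use l\<^sub>0(2)[OF \<open>l k \<ge> 0\<close>] k in \<open>simp add: c_def\<close>)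
    also have "\<dots> = (real k * L) powr - (1 + \<epsilon>)"
      using L k by (simp add: LL powr_def algebra_simps)
    also have "\<dots> = L powr - (1 + \<epsilon>) * real k powr - (1 + \<epsilon>)"
      using L by (simp add: powr_mult)
    finally show ?thesis .
  qed
  have "summable (\<lambda>k. prob (B k))"
  proof (rule summable_comparison_test_ev)
    show "\<forall>\<^sub>F k in sequentially. norm (prob (B k)) \<le> L powr - (1 + \<epsilon>) * real k powr - (1 + \<epsilon>)"
      using good by eventually_elim (use B_prob in auto)
    show "summable (\<lambda>k. L powr - (1 + \<epsilon>) * real k powr - (1 + \<epsilon>))"
      using assms by (intro summable_mult) (simp add: summable_real_powr_iff)
  qed
  then have "AE \<omega> in M. \<forall>\<^sub>F k in sequentially. \<omega> \<in> space M - B k"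
    by (intro borel_cantelli_AE1) (auto simp: emeasure_eq_measure)
  then show ?thesis
  proof (rule AE_mp, intro AE_I2 impI)
    fix \<omega> assume \<omega>: "\<omega> \<in> space M" and "\<forall>\<^sub>F k in sequentially. \<omega> \<in> space M - B k"
    from good this(2) have "\<forall>\<^sub>F k in sequentially. \<omega> \<notin> B k \<and> \<theta> ^ k \<ge> 3"
      by eventually_elim auto
    then obtain k\<^sub>1 where k\<^sub>1: "\<And>k. k \<ge> k\<^sub>1 \<Longrightarrow> \<omega> \<notin> B k \<and> \<theta> ^ k \<ge> 3"
      by (auto simp: eventually_sequentially)
    have "\<forall>\<^sub>F n in sequentially. real n \<ge> max 1 (\<theta> ^ Suc k\<^sub>1)"
      using filterlim_real_sequentially unfolding filterlim_at_top by blast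
    then show "\<forall>\<^sub>F n in sequentially. S n \<omega> < (1 + \<epsilon>) * iterated_log_scale (\<sigma>\<^sup>2) (real n)"
    proof eventually_elim
      fix n assume n: "real n \<ge> max 1 (\<theta> ^ Suc k\<^sub>1)"
      then obtain k where k: "\<theta> ^ k \<le> real n" "real n < \<theta> ^ Suc k"
        using ex_power_between[OF \<theta>, of "real n"] by auto
      have "\<theta> ^ Suc k\<^sub>1 < \<theta> ^ Suc k" using n k(2) by linarith
      then have "k \<ge> k\<^sub>1" using power_less_imp_less_exp[OF \<theta>] by fastforce
      with k\<^sub>1 have "\<omega> \<notin> B k" and T3: "\<theta> ^ k \<ge> 3" by auto
      have LLk: "LL k \<ge> 0" using ln_ln_nonneg[OF T3] by (simp add: LL_def)
      have Tpos: "\<theta> ^ k > 0" using T3 by linarith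
      show "S n \<omega> < (1 + \<epsilon>) * iterated_log_scale (\<sigma>\<^sup>2) (real n)"
      proof (rule ccontr)
        assume "\<not> ?thesis"
        then have "S n \<omega> \<ge> (1 + \<epsilon>) * iterated_log_scale (\<sigma>\<^sup>2) (real n)" by simp
        moreover have "iterated_log_scale (\<sigma>\<^sup>2) (\<theta> ^ k) \<le> iterated_log_scale (\<sigma>\<^sup>2) (real n)"
          using T3 k by (intro iterated_log_scale_mono) auto
        ultimately have "S n \<omega> \<ge> (1 + \<epsilon>) * iterated_log_scale (\<sigma>\<^sup>2) (\<theta> ^ k)"
          using assms by (smt (verit) mult_left_mono)
        moreover have "l k \<ge> 0" using LLk Tpos by (simp add: l_def)
        ultimately have "l k * S n \<omega> \<ge> l k * ((1 + \<epsilon>) * iterated_log_scale (\<sigma>\<^sup>2) (\<theta> ^ k))"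
          by (intro mult_left_mono)
        moreover have "l k * iterated_log_scale (\<sigma>\<^sup>2) (\<theta> ^ k) = 2 * LL k"
        proof -
          have "l k * iterated_log_scale (\<sigma>\<^sup>2) (\<theta> ^ k) =
            sqrt (2 * LL k / (\<sigma>\<^sup>2 * \<theta> ^ k) * (2 * \<theta> ^ k * \<sigma>\<^sup>2 * LL k))"
            unfolding l_def iterated_log_scale_def LL_def real_sqrt_mult[symmetric] ..
          also have "2 * LL k / (\<sigma>\<^sup>2 * \<theta> ^ k) * (2 * \<theta> ^ k * \<sigma>\<^sup>2 * LL k) = (2 * LL k)\<^sup>2"
            using \<theta> \<sigma>_pos by (simp add: field_simps power2_eq_square)
          finally show ?thesis using LLk unfolding real_sqrt_abs by simp
        qed
        moreover have "real n * c k \<le> (1 + \<epsilon>) * LL k"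
        proof -
          have c: "c k = (1 + \<delta>) * LL k / \<theta> ^ k"
            using LLk \<theta> \<sigma>_pos by (simp add: c_def l_def field_simps)
          have "real n * c k \<le> (\<theta> * \<theta> ^ k) * c k"
            using k(2) LLk Tpos \<delta> by (intro mult_right_mono) (auto simp: c)
          also have "\<dots> = \<theta> * (1 + \<delta>) * LL k" using \<theta> by (simp add: c)
          also have "\<dots> \<le> (1 + \<epsilon>) * LL k" using \<theta>\<delta> LLk by (rule mult_right_mono)
          finally show ?thesis .
        qed
        ultimately have "l k * S n \<omega> - real n * c k \<ge> (1 + \<epsilon>) * LL k"
          by (simp add: algebra_simps)
        moreover have "n \<le> nat \<lfloor>\<theta> ^ Suc k\<rfloor>" using k(2) by (simp add: le_nat_floor less_imp_le)
        ultimately have "\<omega> \<in> B k" using \<omega> unfolding B_def by blast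
        with \<open>\<omega> \<notin> B k\<close> show False ..
      qed
    qed
  qed
qed

text \<open>
  The characteristic function of the sum is a power that depends only on the number of
  summands.
\<close>

lemma distr_sum_eq:
  assumes "finite I"
  shows "distr M borel (\<lambda>\<omega>. \<Sum>i\<in>I. X i \<omega>) = distr M borel (S (card I))"
proof (rule Levy_uniqueness)
  show "real_distribution (distr M borel (\<lambda>\<omega>. \<Sum>i\<in>I. X i \<omega>))"
    "real_distribution (distr M borel (S (card I)))"
    by (auto intro!: real_distribution_distr)
  have char_sum: "char (distr M borel (\<lambda>\<omega>. \<Sum>i\<in>J. X i \<omega>)) t = char D t ^ card J" for J t
    using char_distr_sum[OF indep_vars_subset[OF indep subset_UNIV], of J t] by (simp add: law)
  show "char (distr M borel (\<lambda>\<omega>. \<Sum>i\<in>I. X i \<omega>)) = char (distr M borel (S (card I)))"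
    using char_sum[of I] char_sum[of "{..<card I}"] by (simp add: S_def[abs_def] fun_eq_iff)
qed

end

text \<open>
  The density on the interval from \<open>t\<close> to \<open>t + 1\<close> is at least its value at \<open>t + 1\<close>.
\<close>

lemma std_normal_tail_ge:
  assumes "t \<ge> 0"
  shows "measure std_normal_distribution {t<..} \<ge> exp (- (t + 1)\<^sup>2 / 2) / sqrt (2 * pi)"
proof -
  interpret N: real_distribution std_normal_distribution
    by (rule real_dist_normal_dist)
  let ?c = "exp (- (t + 1)\<^sup>2 / 2) / sqrt (2 * pi)"
  have "ennreal ?c = (\<integral>\<^sup>+x. ennreal ?c * indicator {t<..t+1} x \<partial>lborel)"
    by (subst nn_integral_cmult_indicator) auto
  also have "\<dots> \<le> (\<integral>\<^sup>+x. ennreal (std_normal_density x) * indicator {t<..} x \<partial>lborel)"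
  proof (rule nn_integral_mono)
    fix x :: real
    have "?c \<le> std_normal_density x" if "t < x" "x \<le> t + 1"
    proof -
      have "x\<^sup>2 \<le> (t + 1)\<^sup>2" using that assms by (intro power_mono) auto
      then show ?thesis by (simp add: std_normal_density_def divide_right_mono)
    qed
    then show "ennreal ?c * indicator {t<..t+1} x \<le> ennreal (std_normal_density x) * indicator {t<..} x"
      by (auto simp: indicator_def intro!: ennreal_leI)
  qed
  also have "\<dots> = emeasure std_normal_distribution {t<..}"
    by (subst emeasure_density) auto
  finally show ?thesis by (simp add: N.emeasure_eq_measure)
qed

context bounded_iid begin

text \<open>
  For a large fixed \<open>t\<close> the normal tail exceeds \<open>exp (- (1 + \<delta>) t\<^sup>2 / 2)\<close>, because \<open>\<delta> t\<^sup>2\<close>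
  dominates the linear and constant terms; the central limit theorem transfers this to \<open>S n\<close>.
\<close>

lemma eventually_tail_ge:
  assumes "\<delta> > 0"
  obtains t where "t > 0"
    "\<forall>\<^sub>F n in sequentially. prob {\<omega>\<in>space M. S n \<omega> \<ge> t * \<sigma> * sqrt (real n)} \<ge> exp (- (1 + \<delta>) * t\<^sup>2 / 2)"
proof -
  have "\<forall>\<^sub>F t in at_top. exp (- (t + 1)\<^sup>2 / 2) / sqrt (2 * pi) > exp (- (1 + \<delta>) * t\<^sup>2 / 2)"
  proof -
    define C where "C = ln (sqrt (2 * pi))"
    have "filterlim (\<lambda>t::real. \<delta> / 2 * t\<^sup>2 - t - 1 / 2 - C) at_top at_top"
      using assms by real_asymp
    then have "\<forall>\<^sub>F t::real in at_top. \<delta> / 2 * t\<^sup>2 - t - 1 / 2 - C > 0"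
      unfolding filterlim_at_top_dense by blast
    then show ?thesis
    proof eventually_elim
      fix t :: real assume "\<delta> / 2 * t\<^sup>2 - t - 1 / 2 - C > 0"
      then have "- (1 + \<delta>) * t\<^sup>2 / 2 < - (t + 1)\<^sup>2 / 2 - C"
        by (simp add: power2_eq_square field_simps)
      then have "exp (- (1 + \<delta>) * t\<^sup>2 / 2) < exp (- (t + 1)\<^sup>2 / 2 - C)" by simp
      also have "\<dots> = exp (- (t + 1)\<^sup>2 / 2) / sqrt (2 * pi)"
        unfolding C_def exp_diff by (subst exp_ln) auto
      finally show "exp (- (1 + \<delta>) * t\<^sup>2 / 2) < exp (- (t + 1)\<^sup>2 / 2) / sqrt (2 * pi)" .
    qed
  qed
  then have "\<forall>\<^sub>F t in at_top. exp (- (t + 1)\<^sup>2 / 2) / sqrt (2 * pi) > exp (- (1 + \<delta>) * t\<^sup>2 / 2) \<and> t > 0"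
    using eventually_gt_at_top[of 0] by eventually_elim simp
  then obtain t where t: "exp (- (t + 1)\<^sup>2 / 2) / sqrt (2 * pi) > exp (- (1 + \<delta>) * t\<^sup>2 / 2)" "t > 0"
    by (auto simp: eventually_at_top_linorder)
  interpret N: real_distribution std_normal_distribution
    by (rule real_dist_normal_dist)
  let ?Z = "\<lambda>n \<omega>. (\<Sum>i<n. X i \<omega>) / sqrt (real n * \<sigma>\<^sup>2)"
  have "measure std_normal_distribution {t} = 0"
    by (simp add: measure_def emeasure_density nn_integral_0_iff_AE)
  then have "isCont (cdf std_normal_distribution) t" by (simp add: N.isCont_cdf)
  moreover have "weak_conv_m (\<lambda>n. distr M borel (?Z n)) std_normal_distribution"
    by (rule central_limit_theorem_zero_mean[OF indep mean \<sigma>_pos integrable_X_square variance law])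
  ultimately have "(\<lambda>n. cdf (distr M borel (?Z n)) t) \<longlonglongrightarrow> cdf std_normal_distribution t"
    by (simp add: weak_conv_m_def weak_conv_def)
  moreover have "1 - cdf std_normal_distribution t = measure std_normal_distribution {t<..}"
  proof -
    have "{t<..} = space std_normal_distribution - {..t}" by auto
    then show ?thesis by (simp only: cdf_def) (subst N.prob_compl, auto)
  qed
  then have "cdf std_normal_distribution t < 1 - exp (- (1 + \<delta>) * t\<^sup>2 / 2)"
    using std_normal_tail_ge[of t] t by linarith
  ultimately have "\<forall>\<^sub>F n in sequentially. cdf (distr M borel (?Z n)) t < 1 - exp (- (1 + \<delta>) * t\<^sup>2 / 2)"
    by (rule order_tendstoD)
  moreover have "\<forall>\<^sub>F n::nat in sequentially. n > 0" by (rule eventually_gt_at_top)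
  ultimately have "\<forall>\<^sub>F n in sequentially. prob {\<omega>\<in>space M. S n \<omega> \<ge> t * \<sigma> * sqrt (real n)} \<ge> exp (- (1 + \<delta>) * t\<^sup>2 / 2)"
  proof eventually_elim
    fix n :: nat assume n: "n > 0" and cdf: "cdf (distr M borel (?Z n)) t < 1 - exp (- (1 + \<delta>) * t\<^sup>2 / 2)"
    have "cdf (distr M borel (?Z n)) t = prob {\<omega>\<in>space M. ?Z n \<omega> \<le> t}"
      unfolding cdf_def by (subst measure_distr) (auto intro!: arg_cong[where f = prob])
    also have "\<dots> = 1 - prob {\<omega>\<in>space M. \<not> ?Z n \<omega> \<le> t}"
      by (subst prob_neg) auto
    finally have "exp (- (1 + \<delta>) * t\<^sup>2 / 2) \<le> prob {\<omega>\<in>space M. \<not> ?Z n \<omega> \<le> t}" using cdf by simp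
    also have "\<dots> \<le> prob {\<omega>\<in>space M. S n \<omega> \<ge> t * \<sigma> * sqrt (real n)}"
    proof (rule finite_measure_mono)
      have "S n \<omega> \<ge> t * \<sigma> * sqrt (real n)" if "\<not> ?Z n \<omega> \<le> t" for \<omega>
        using that n \<sigma>_pos by (simp add: S_def real_sqrt_mult field_simps)
      then show "{\<omega>\<in>space M. \<not> ?Z n \<omega> \<le> t} \<subseteq> {\<omega>\<in>space M. S n \<omega> \<ge> t * \<sigma> * sqrt (real n)}" by blast
    qed measurable
    finally show "prob {\<omega>\<in>space M. S n \<omega> \<ge> t * \<sigma> * sqrt (real n)} \<ge> exp (- (1 + \<delta>) * t\<^sup>2 / 2)" .
  qed
  with t(2) that show ?thesis by blast
qed

end

section \<open>The lower half of the law of the iterated logarithm\<close>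

text \<open>
  Stretch \<open>k\<close> consists of \<open>block_number c k\<close> blocks of length \<open>m ^ k\<close> and begins at index
  \<open>block_start c m k\<close>. The number of blocks grows like \<open>c ln k\<close>, that is, like \<open>c ln ln\<close> of the
  index reached.
\<close>

definition block_number :: "real \<Rightarrow> nat \<Rightarrow> nat" where
  "block_number c k = nat \<lceil>c * ln (real (Suc k))\<rceil>"

definition block_start :: "real \<Rightarrow> nat \<Rightarrow> nat \<Rightarrow> nat" where
  "block_start c m k = (\<Sum>i<k. block_number c i * m ^ i)"

context bounded_iid begin

text \<open>
  The central limit theorem alone does not reach deviations of size \<open>sqrt (ln ln n)\<close>
  standard deviations. They are produced by asking that each block of a stretch exceed the
  level of \<open>t\<close> standard deviations, \<open>t\<close> being fixed: by independence this has probability at least \<open>exp (- s) ^ block_number c k\<close>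
  with \<open>s = (1 + \<delta>) t\<^sup>2 / 2 = 1 / c\<close>, which is of order \<open>1 / k\<close>. These probabilities have a
  divergent sum, and different stretches are independent.
\<close>

lemma frequently_block_sum_ge:
  assumes t: "t > 0" and \<delta>: "\<delta> > 0" and m: "m \<ge> 2"
    and tail: "\<forall>\<^sub>F n in sequentially. prob {\<omega>\<in>space M. S n \<omega> \<ge> t * \<sigma> * sqrt (real n)} \<ge> exp (- (1 + \<delta>) * t\<^sup>2 / 2)"
  defines "c \<equiv> 2 / ((1 + \<delta>) * t\<^sup>2)"
  shows "AE \<omega> in M. \<exists>\<^sub>F k in sequentially. S (block_start c m (Suc k)) \<omega> - S (block_start c m k) \<omega>
      \<ge> real (block_number c k) * (t * \<sigma> * sqrt (real m ^ k))"
proof -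
  define j where "j = block_number c"
  define a where "a = block_start c m"
  have a_Suc: "a (Suc k) = a k + j k * m ^ k" for k by (simp add: a_def j_def block_start_def)
  have a_mono: "a k \<le> a k'" if "k \<le> k'" for k k'
    by (rule lift_Suc_mono_le[OF _ that]) (simp add: a_Suc)
  define I where "I k i = {a k + i * m ^ k ..< a k + Suc i * m ^ k}" for k i
  have I_sub: "I k i \<subseteq> {a k..<a (Suc k)}" if "i < j k" for k i
  proof -
    have "Suc i * m ^ k \<le> j k * m ^ k" using that by (intro mult_right_mono) auto
    then show ?thesis by (auto simp: I_def a_Suc)
  qed
  have I_disj: "disjoint_family_on (I k) {..<j k}" for k
  proof (unfold disjoint_family_on_def, intro ballI impI)
    have "I k i \<inter> I k i' = {}" if "i < i'" for i i'
    proof -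
      have "Suc i * m ^ k \<le> i' * m ^ k" using that by (intro mult_right_mono) auto
      then show ?thesis by (auto simp: I_def)
    qed
    then show "I k i \<inter> I k i' = {}" if "i \<noteq> i'" for i i'
      using that by (metis inf_commute nat_neq_iff)
  qed
  \<comment> \<open>\<open>I k i\<close> is the block \<open>i\<close> of stretch \<open>k\<close>; \<open>Y k \<in> B k\<close> says that all blocks of stretch \<open>k\<close> succeed.\<close>
  define u where "u k = t * \<sigma> * sqrt (real m ^ k)" for k
  define B where "B k = {x \<in> space (PiM {a k..<a (Suc k)} (\<lambda>_. borel :: real measure)). \<forall>i\<in>{..<j k}. u k \<le> (\<Sum>l\<in>I k i. x l)}" for k
  define Y where "Y k \<omega> = (\<lambda>l\<in>{a k..<a (Suc k)}. X l \<omega>)" for k \<omega>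
  have indep_Y: "indep_vars (\<lambda>k. PiM {a k..<a (Suc k)} (\<lambda>_. borel)) Y UNIV"
    unfolding Y_def[abs_def]
  proof (rule indep_vars_restrict[OF indep])
    show "disjoint_family_on (\<lambda>k. {a k..<a (Suc k)}) UNIV"
    proof (unfold disjoint_family_on_def, intro ballI impI)
      have "{a k..<a (Suc k)} \<inter> {a k'..<a (Suc k')} = {}" if "k < k'" for k k'
        using a_mono[of "Suc k" k'] that by auto
      then show "{a k..<a (Suc k)} \<inter> {a k'..<a (Suc k')} = {}" if "k \<noteq> k'" for k k'
        using that by (metis inf_commute nat_neq_iff)
    qed
  qed auto
  have B_meas: "B k \<in> sets (PiM {a k..<a (Suc k)} (\<lambda>_. borel))" for k
    unfolding B_def
  proof (rule sets.sets_Collect_finite_All)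
    fix i assume "i \<in> {..<j k}"
    then have "(\<lambda>x. \<Sum>l\<in>I k i. x l :: real) \<in> borel_measurable (PiM {a k..<a (Suc k)} (\<lambda>_. borel))"
      using I_sub[of i k] by (intro borel_measurable_sum measurable_component_singleton) auto
    then show "{x \<in> space (PiM {a k..<a (Suc k)} (\<lambda>_. borel :: real measure)). u k \<le> (\<Sum>l\<in>I k i. x l)} \<in> sets (PiM {a k..<a (Suc k)} (\<lambda>_. borel))"
      by measurable
  qed simp
  have Y_sum: "(\<Sum>l\<in>I k i. Y k \<omega> l) = (\<Sum>l\<in>I k i. X l \<omega>)" if "i < j k" for k i \<omega>
    using I_sub[OF that] by (intro sum.cong) (auto simp: Y_def)
  have Y_B: "Y k \<omega> \<in> B k \<longleftrightarrow> (\<forall>i<j k. u k \<le> (\<Sum>l\<in>I k i. X l \<omega>))" if "\<omega> \<in> space M" for k \<omega>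
  proof -
    have "Y k \<omega> \<in> space (PiM {a k..<a (Suc k)} (\<lambda>_. borel))" by (simp add: Y_def space_PiM)
    then show ?thesis using Y_sum by (auto simp: B_def)
  qed
  have prob_B: "prob (Y k -` B k \<inter> space M) = prob {\<omega>\<in>space M. u k \<le> S (m ^ k) \<omega>} ^ j k" for k
  proof (cases "j k = 0")
    case True
    then have "Y k -` B k \<inter> space M = space M" using Y_B by auto
    then show ?thesis using True by (simp add: prob_space)
  next
    case False
    have ind: "indep_vars (\<lambda>i. PiM (I k i) (\<lambda>_. borel)) (\<lambda>i \<omega>. \<lambda>l\<in>I k i. X l \<omega>) {..<j k}"
      by (rule indep_vars_restrict[OF indep _ I_disj]) auto
    have meas: "{x \<in> space (PiM (I k i) (\<lambda>_. borel :: real measure)). u k \<le> (\<Sum>l\<in>I k i. x l)} \<in> sets (PiM (I k i) (\<lambda>_. borel))" for i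
      by measurable
    have blk: "(\<lambda>\<omega>. \<lambda>l\<in>I k i. X l \<omega>) -` {x \<in> space (PiM (I k i) (\<lambda>_. borel)). u k \<le> (\<Sum>l\<in>I k i. x l)} \<inter> space M =
      {\<omega>\<in>space M. u k \<le> (\<Sum>l\<in>I k i. X l \<omega>)}" for i
      by (auto simp: space_PiM)
    have law_blk: "prob {\<omega>\<in>space M. u k \<le> (\<Sum>l\<in>I k i. X l \<omega>)} = prob {\<omega>\<in>space M. u k \<le> S (m ^ k) \<omega>}" for i
    proof -
      have "prob {\<omega>\<in>space M. u k \<le> (\<Sum>l\<in>I k i. X l \<omega>)} = measure (distr M borel (\<lambda>\<omega>. \<Sum>l\<in>I k i. X l \<omega>)) {u k..}"
        by (subst measure_distr) (auto intro!: arg_cong[where f = prob])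
      also have "\<dots> = measure (distr M borel (S (m ^ k))) {u k..}"
        by (subst distr_sum_eq) (auto simp: I_def)
      also have "\<dots> = prob {\<omega>\<in>space M. u k \<le> S (m ^ k) \<omega>}"
        by (subst measure_distr) (auto intro!: arg_cong[where f = prob])
      finally show ?thesis .
    qed
    have "Y k -` B k \<inter> space M = (\<Inter>i\<in>{..<j k}. {\<omega>\<in>space M. u k \<le> (\<Sum>l\<in>I k i. X l \<omega>)})"
      using Y_B False by auto
    also have "prob \<dots> = (\<Prod>i\<in>{..<j k}. prob {\<omega>\<in>space M. u k \<le> (\<Sum>l\<in>I k i. X l \<omega>)})"
      using indep_varsD_finite[OF ind, of "\<lambda>i. {x \<in> space (PiM (I k i) (\<lambda>_. borel)). u k \<le> (\<Sum>l\<in>I k i. x l)}"] False meas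
      unfolding blk by (simp add: lessThan_empty_iff)
    also have "\<dots> = prob {\<omega>\<in>space M. u k \<le> S (m ^ k) \<omega>} ^ j k" by (simp add: law_blk)
    finally show ?thesis .
  qed
  have "\<not> summable (\<lambda>k. prob (Y k -` B k \<inter> space M))"
  proof
    assume sm: "summable (\<lambda>k. prob (Y k -` B k \<inter> space M))"
    define s where "s = (1 + \<delta>) * t\<^sup>2 / 2"
    have s: "s > 0" "c * s = 1" using t \<delta> by (auto simp: s_def c_def)
    have lim: "filterlim (\<lambda>k. m ^ k) at_top sequentially"
      using m by (intro filterlim_at_top_mono[OF filterlim_ident] always_eventually allI self_le_ge2_pow)
    have "\<forall>\<^sub>F k in sequentially. prob {\<omega>\<in>space M. S (m ^ k) \<omega> \<ge> t * \<sigma> * sqrt (real (m ^ k))} \<ge> exp (- (1 + \<delta>) * t\<^sup>2 / 2)"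
      using eventually_compose_filterlim[OF tail lim] .
    then have "\<forall>\<^sub>F k in sequentially. norm (exp (- s) * inverse (real (Suc k))) \<le> prob (Y k -` B k \<inter> space M)"
    proof eventually_elim
      fix k assume *: "prob {\<omega>\<in>space M. S (m ^ k) \<omega> \<ge> t * \<sigma> * sqrt (real (m ^ k))} \<ge> exp (- (1 + \<delta>) * t\<^sup>2 / 2)"
      have "0 \<le> c * ln (real (Suc k))" using s by (intro mult_nonneg_nonneg) (auto simp: c_def)
      then have "real (j k) \<le> c * ln (real (Suc k)) + 1"
        unfolding j_def block_number_def by linarith
      then have "s * real (j k) \<le> s * (c * ln (real (Suc k)) + 1)" using s by (intro mult_left_mono) auto
      also have "\<dots> = c * s * ln (real (Suc k)) + s" by (simp add: algebra_simps)
      also have "\<dots> = ln (real (Suc k)) + s" by (simp add: s)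
      finally have "exp (- (ln (real (Suc k)) + s)) \<le> exp (- (s * real (j k)))" by simp
      moreover have "exp (- (ln (real (Suc k)) + s)) = exp (- s) * inverse (real (Suc k))"
        by (simp add: exp_diff exp_minus field_simps)
      moreover have "exp (- (s * real (j k))) = exp (- s) ^ j k"
        by (simp add: mult.commute flip: exp_of_nat_mult)
      moreover have "exp (- s) ^ j k \<le> prob {\<omega>\<in>space M. u k \<le> S (m ^ k) \<omega>} ^ j k"
      proof (rule power_mono)
        have "- (1 + \<delta>) * t\<^sup>2 / 2 = - s" by (simp add: s_def algebra_simps)
        with * show "exp (- s) \<le> prob {\<omega>\<in>space M. u k \<le> S (m ^ k) \<omega>}" by (simp add: u_def)
      qed simp
      ultimately show "norm (exp (- s) * inverse (real (Suc k))) \<le> prob (Y k -` B k \<inter> space M)"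
        unfolding prob_B by simp
    qed
    then have "summable (\<lambda>k. exp (- s) * inverse (real (Suc k)))"
      using sm by (rule summable_comparison_test_ev)
    then have "summable (\<lambda>k. inverse (real (Suc k)))" by (simp add: summable_cmult_iff)
    then show False
      using not_summable_harmonic[where 'a = real] summable_Suc_iff[of "\<lambda>n. inverse (real n)"] by simp
  qed
  from borel_cantelli_indep_vars[OF indep_Y B_meas this]
  show ?thesis
  proof (rule AE_mp, intro AE_I2 impI)
    fix \<omega> assume \<omega>: "\<omega> \<in> space M" and "\<exists>\<^sub>F k in sequentially. Y k \<omega> \<in> B k"
    from this(2) show "\<exists>\<^sub>F k in sequentially. S (block_start c m (Suc k)) \<omega> - S (block_start c m k) \<omega>
      \<ge> real (block_number c k) * (t * \<sigma> * sqrt (real m ^ k))"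
    proof (rule frequently_elim1)
      fix k assume "Y k \<omega> \<in> B k"
      then have ge: "u k \<le> (\<Sum>l\<in>I k i. X l \<omega>)" if "i < j k" for i using Y_B[OF \<omega>] that by blast
      have "(\<Sum>l\<in>{0..<a k}. X l \<omega>) + (\<Sum>l\<in>{a k..<a (Suc k)}. X l \<omega>) = (\<Sum>l\<in>{0..<a (Suc k)}. X l \<omega>)"
        using a_mono[of k "Suc k"] by (intro sum.atLeastLessThan_concat) auto
      then have "S (a (Suc k)) \<omega> = S (a k) \<omega> + (\<Sum>l\<in>{a k..<a (Suc k)}. X l \<omega>)"
        by (simp add: S_def lessThan_atLeast0)
      moreover have "(\<Sum>l\<in>{a k..<a (Suc k)}. X l \<omega>) = (\<Sum>i<j k. \<Sum>l\<in>I k i. X l \<omega>)"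
      proof -
        have "(\<Sum>i<j k. \<Sum>l\<in>I k i. X l \<omega>) = (\<Sum>i<j k. \<Sum>l\<in>{i * m ^ k..<i * m ^ k + m ^ k}. X (l + a k) \<omega>)"
        proof (rule sum.cong[OF refl])
          fix i
          show "(\<Sum>l\<in>I k i. X l \<omega>) = (\<Sum>l\<in>{i * m ^ k..<i * m ^ k + m ^ k}. X (l + a k) \<omega>)"
            unfolding I_def by (rule sum.reindex_bij_witness[of _ "\<lambda>l. l + a k" "\<lambda>l. l - a k"]) auto
        qed
        also have "\<dots> = (\<Sum>l<j k * m ^ k. X (l + a k) \<omega>)" by (rule sum.nat_group)
        also have "\<dots> = (\<Sum>l\<in>{a k..<a (Suc k)}. X l \<omega>)"
          unfolding a_Suc by (rule sum.reindex_bij_witness[of _ "\<lambda>l. l - a k" "\<lambda>l. l + a k"]) auto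
        finally show ?thesis by simp
      qed
      moreover have "(\<Sum>i<j k. \<Sum>l\<in>I k i. X l \<omega>) \<ge> (\<Sum>i<j k. u k)"
        using ge by (intro sum_mono) auto
      ultimately have "S (a (Suc k)) \<omega> - S (a k) \<omega> \<ge> real (j k) * u k" by simp
      then show "S (block_start c m (Suc k)) \<omega> - S (block_start c m k) \<omega>
        \<ge> real (block_number c k) * (t * \<sigma> * sqrt (real m ^ k))"
        by (simp add: a_def j_def u_def)
    qed
  qed
qed

end

lemma block_number_mono:
  assumes "c \<ge> 0" "k \<le> l"
  shows "block_number c k \<le> block_number c l"
proof -
  have "c * ln (real (Suc k)) \<le> c * ln (real (Suc l))"
    using assms by (intro mult_left_mono) auto
  then show ?thesis unfolding block_number_def by (intro nat_mono ceiling_mono)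
qed

lemma block_start_Suc:
  "block_start c m (Suc k) = block_start c m k + block_number c k * m ^ k"
  by (simp add: block_start_def)

text \<open>
  The block lengths grow geometrically, so the last stretch makes up all but at most a
  fraction \<open>1 / m\<close> of everything before its end.
\<close>

lemma block_start_le:
  assumes "c \<ge> 0"
  shows "(m - 1) * block_start c m k \<le> block_number c k * m ^ k"
proof (cases "m = 0")
  case False
  show ?thesis
  proof (induction k)
    case (Suc k)
    have "(m - 1) * block_start c m (Suc k) \<le> block_number c k * m ^ k + (m - 1) * (block_number c k * m ^ k)"
      using Suc by (simp add: block_start_Suc distrib_left)
    also have "\<dots> = m * (block_number c k * m ^ k)"
      using False by (metis Suc_pred' mult_Suc neq0_conv One_nat_def)
    also have "\<dots> = block_number c k * m ^ Suc k" by simp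
    also have "\<dots> \<le> block_number c (Suc k) * m ^ Suc k"
      using block_number_mono[OF assms, of k "Suc k"] by (intro mult_right_mono) auto
    finally show ?case .
  qed (simp add: block_start_def)
qed simp

lemma block_start_ge:
  assumes "c > 0" "m \<ge> 1"
  shows "k \<le> block_start c m (Suc k)"
proof (induction k)
  case (Suc k)
  have "c * ln (real (Suc (Suc k))) > 0" using assms by (intro mult_pos_pos) auto
  then have "block_number c (Suc k) \<ge> 1" unfolding block_number_def by linarith
  moreover have "m ^ Suc k \<ge> 1" using assms by simp
  ultimately have "1 * 1 \<le> block_number c (Suc k) * m ^ Suc k" by (intro mult_mono) auto
  then show ?case using Suc unfolding block_start_Suc[of c m "Suc k"] by linarith
qed simp

text \<open>
  The end of stretch \<open>k\<close> is at most \<open>m ^ (k + 1)\<close> times a factor that is logarithmic in \<open>k\<close>, so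
  its logarithm grows linearly in \<open>k\<close>.
\<close>

lemma eventually_ln_ln_block_start_le:
  assumes c: "c > 0" and m: "m \<ge> 2" and \<delta>: "\<delta> > 0"
  shows "\<forall>\<^sub>F k in sequentially. ln (ln (real (block_start c m (Suc k)))) \<le> (1 + \<delta>) * ln (real (Suc k))"
proof -
  define lm where "lm = ln (real m)"
  have lm: "lm > 0" using m by (simp add: lm_def)
  have "((\<lambda>k. ln (ln (c * ln (real k + 2) + 1) + (real k + 1) * lm) / ln (real k + 1)) \<longlongrightarrow> 1) sequentially"
    using c lm by real_asymp
  then have "\<forall>\<^sub>F k in sequentially. ln (ln (c * ln (real k + 2) + 1) + (real k + 1) * lm) / ln (real k + 1) < 1 + \<delta>"
    by (rule order_tendstoD) (use \<delta> in simp)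
  moreover have "\<forall>\<^sub>F k::nat in sequentially. k \<ge> 2" by (rule eventually_ge_at_top)
  ultimately show ?thesis
  proof eventually_elim
    fix k :: nat
    assume asymp: "ln (ln (c * ln (real k + 2) + 1) + (real k + 1) * lm) / ln (real k + 1) < 1 + \<delta>"
      and k: "k \<ge> 2"
    define n where "n = block_start c m (Suc k)"
    have n2: "n \<ge> 2" using block_start_ge[of c m k] c m k by (simp add: n_def)
    have ln_pos: "c * ln (real k + 2) > 0" using c by (intro mult_pos_pos) auto
    have "1 * n \<le> (m - 1) * n" using m by (intro mult_right_mono) auto
    then have "n \<le> (m - 1) * n" by simp
    also have "\<dots> \<le> block_number c (Suc k) * m ^ Suc k"
      unfolding n_def using c by (intro block_start_le) simp
    finally have "real n \<le> real (block_number c (Suc k)) * real m ^ Suc k"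
      by (metis of_nat_le_iff of_nat_mult of_nat_power)
    also have "real (block_number c (Suc k)) \<le> c * ln (real k + 2) + 1"
      using ln_pos unfolding block_number_def by (simp add: add.commute) linarith
    finally have "real n \<le> (c * ln (real k + 2) + 1) * real m ^ Suc k"
      by (simp add: mult_right_mono)
    then have "ln (real n) \<le> ln ((c * ln (real k + 2) + 1) * real m ^ Suc k)"
      using n2 by (intro ln_mono) auto
    also have "\<dots> = ln (c * ln (real k + 2) + 1) + (real k + 1) * lm"
      using ln_pos m by (subst ln_mult) (auto simp: lm_def ln_realpow simp del: power_Suc)
    finally have "ln (ln (real n)) \<le> ln (ln (c * ln (real k + 2) + 1) + (real k + 1) * lm)"
      using n2 by (intro ln_mono) auto
    also have "\<dots> \<le> (1 + \<delta>) * ln (real k + 1)"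
      using asymp k by (simp add: field_simps)
    finally show "ln (ln (real (block_start c m (Suc k)))) \<le> (1 + \<delta>) * ln (real (Suc k))"
      by (simp add: n_def add.commute)
  qed
qed

lemma iterated_log_scale_nonneg: "v \<ge> 0 \<Longrightarrow> x \<ge> 3 \<Longrightarrow> iterated_log_scale v x \<ge> 0"
  using ln_ln_nonneg[of x] by (simp add: iterated_log_scale_def)

lemma iterated_log_scale_block_start_le:
  assumes "c > 0" "m \<ge> 2" "v \<ge> 0" "block_start c m k \<ge> 3"
  shows "iterated_log_scale v (real (block_start c m k)) \<le>
         iterated_log_scale v (real (block_start c m (Suc k))) / sqrt (real m)"
proof -
  define a where "a = real (block_start c m k)"
  define n where "n = real (block_start c m (Suc k))"
  have "m * block_start c m k = block_start c m k + (m - 1) * block_start c m k"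
    using assms(2) by (cases m) auto
  also have "\<dots> \<le> block_start c m (Suc k)"
    using block_start_le[of c m k] assms(1) by (simp add: block_start_Suc)
  finally have ma: "real m * a \<le> n"
    unfolding a_def n_def by (metis of_nat_le_iff of_nat_mult)
  have a3: "a \<ge> 3" using assms by (simp add: a_def)
  have an: "a \<le> n" by (simp add: a_def n_def block_start_Suc)
  have "real m * (2 * a * v * ln (ln a)) = 2 * (real m * a) * v * ln (ln a)" by simp
  also have "\<dots> \<le> 2 * n * v * ln (ln n)"
    using ma an a3 assms ln_ln_nonneg[OF a3] ln_ln_mono[OF a3 an] by (intro mult_mono) auto
  finally have "sqrt (real m * (2 * a * v * ln (ln a))) \<le> sqrt (2 * n * v * ln (ln n))"
    by (rule real_sqrt_le_mono)
  then have "sqrt (real m) * iterated_log_scale v a \<le> iterated_log_scale v n"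
    by (simp only: real_sqrt_mult iterated_log_scale_def)
  then show ?thesis using assms(2) by (simp add: a_def n_def field_simps)
qed

text \<open>
  Compare the squares: \<open>t\<^sup>2\<close> times the number of blocks is at least about \<open>2 ln ln n\<close> by the
  choice of \<open>c\<close>, and the total length of the blocks is at least \<open>n (1 - 1 / m)\<close>.
\<close>

lemma block_sum_bound_ge:
  fixes k :: nat
  assumes t: "t > 0" and \<delta>: "\<delta> > 0" and m: "m \<ge> 2" and \<sigma>: "\<sigma> > 0"
  defines "c \<equiv> 2 / ((1 + \<delta>) * t\<^sup>2)"
  defines "n \<equiv> real (block_start c m (Suc k))"
  assumes n: "n \<ge> 3" and lnln: "ln (ln n) \<le> (1 + \<delta>) * ln (real (Suc k))"
  shows "real (block_number c k) * (t * \<sigma> * sqrt (real m ^ k)) \<ge>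
         sqrt (1 - 1 / real m) / (1 + \<delta>) * iterated_log_scale (\<sigma>\<^sup>2) n"
proof (rule power2_le_imp_le)
  define j where "j = real (block_number c k)"
  have c: "c > 0" using t \<delta> by (simp add: c_def)
  have j: "j \<ge> c * ln (real (Suc k))" unfolding j_def block_number_def by linarith
  have len: "j * real m ^ k \<ge> n * (1 - 1 / real m)"
  proof -
    have "real (m - 1) * real (block_start c m k) \<le> j * real m ^ k"
      using block_start_le[of c m k] c unfolding j_def
      by (metis less_imp_le of_nat_le_iff of_nat_mult of_nat_power)
    moreover have "real (m - 1) = real m - 1" using m by simp
    moreover have "n = real (block_start c m k) + j * real m ^ k"
      by (simp add: n_def j_def block_start_Suc)
    ultimately have "(real m - 1) * n \<le> real m * (j * real m ^ k)"
      by (simp add: algebra_simps)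
    then show ?thesis using m by (simp add: field_simps)
  qed
  have "2 * ln (ln n) / (1 + \<delta>)\<^sup>2 \<le> 2 * ((1 + \<delta>) * ln (real (Suc k))) / (1 + \<delta>)\<^sup>2"
    using lnln \<delta> by (intro divide_right_mono mult_left_mono) auto
  also have "\<dots> = t\<^sup>2 * (c * ln (real (Suc k)))"
  proof -
    have "2 * ((1 + \<delta>) * ln (real (Suc k))) / (1 + \<delta>)\<^sup>2 = 2 * ln (real (Suc k)) / (1 + \<delta>)"
      using \<delta> by (simp add: power2_eq_square)
    moreover have "t\<^sup>2 * (c * ln (real (Suc k))) = 2 * ln (real (Suc k)) / (1 + \<delta>)"
      using t by (simp add: c_def)
    ultimately show ?thesis by simp
  qed
  also have "\<dots> \<le> t\<^sup>2 * j" using j by (intro mult_left_mono) auto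
  finally have level: "2 * ln (ln n) / (1 + \<delta>)\<^sup>2 \<le> t\<^sup>2 * j" .
  have "(sqrt (1 - 1 / real m) / (1 + \<delta>) * iterated_log_scale (\<sigma>\<^sup>2) n)\<^sup>2 =
     (1 - 1 / real m) / (1 + \<delta>)\<^sup>2 * (2 * n * \<sigma>\<^sup>2 * ln (ln n))"
    using m n ln_ln_nonneg[OF n] by (simp add: power_mult_distrib power_divide iterated_log_scale_def)
  also have "\<dots> = \<sigma>\<^sup>2 * ((2 * ln (ln n) / (1 + \<delta>)\<^sup>2) * (n * (1 - 1 / real m)))"
    by (simp add: field_simps)
  also have "\<dots> \<le> \<sigma>\<^sup>2 * ((t\<^sup>2 * j) * (j * real m ^ k))"
    using m n t by (intro mult_left_mono[OF mult_mono[OF level len]]) (auto simp: j_def)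
  also have "\<dots> = (j * (t * \<sigma> * sqrt (real m ^ k)))\<^sup>2"
    by (simp add: power_mult_distrib power2_eq_square)
  finally show "(sqrt (1 - 1 / real m) / (1 + \<delta>) * iterated_log_scale (\<sigma>\<^sup>2) n)\<^sup>2 \<le>
     (real (block_number c k) * (t * \<sigma> * sqrt (real m ^ k)))\<^sup>2" by (simp only: j_def)
  show "0 \<le> real (block_number c k) * (t * \<sigma> * sqrt (real m ^ k))" using t \<sigma> by simp
qed

context bounded_iid begin

lemma bounded_iid_uminus: "bounded_iid M (\<lambda>n \<omega>. - X n \<omega>) (distr D borel uminus) \<sigma> K"
proof unfold_locales
  show "indep_vars (\<lambda>_. borel) (\<lambda>n \<omega>. - X n \<omega>) UNIV"
    by (rule indep_vars_compose2[OF indep]) simp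
  show "distr M borel (\<lambda>\<omega>. - X n \<omega>) = distr D borel uminus" for n
    by (subst law[of n, symmetric], subst distr_distr) (auto simp: comp_def)
  show "prob_space.expectation M (\<lambda>\<omega>. - X n \<omega>) = 0" for n using mean[of n] by simp
  show "expectation (\<lambda>x. (- X n x - expectation (\<lambda>\<omega>. - X n \<omega>))\<^sup>2) = \<sigma>\<^sup>2" for n
    using variance[of n] mean[of n] by simp
qed (use \<sigma>_pos bounded in auto)

text \<open>
  At the end \<open>n\<close> of a successful stretch, the stretch contributes almost the full scale. What
  came before it is at least \<open>-2\<close> times the scale at the beginning of the stretch, by the upper
  half applied to \<open>- X\<close>, and this is only a fraction \<open>2 / sqrt m\<close> of the scale at \<open>n\<close>. Finally
  \<open>m\<close> is chosen large.
\<close>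

theorem frequently_ge_iterated_log_scale:
  assumes "\<epsilon> > 0"
  shows "AE \<omega> in M. \<exists>\<^sub>F n in sequentially. S n \<omega> \<ge> (1 - \<epsilon>) * iterated_log_scale (\<sigma>\<^sup>2) (real n)"
proof -
  \<comment> \<open>chosen such that \<open>1 - \<epsilon> < 1 / (1 + \<delta>)\<close>\<close>
  define \<delta> where "\<delta> = \<epsilon> / 2"
  have \<delta>: "\<delta> > 0" using assms by (simp add: \<delta>_def)
  obtain t where t: "t > 0"
    "\<forall>\<^sub>F n in sequentially. prob {\<omega>\<in>space M. S n \<omega> \<ge> t * \<sigma> * sqrt (real n)} \<ge> exp (- (1 + \<delta>) * t\<^sup>2 / 2)"
    using eventually_tail_ge[OF \<delta>] by blast
  have "((\<lambda>m::nat. sqrt (1 - 1 / real m) / (1 + \<delta>) - 2 / sqrt (real m)) \<longlongrightarrow> 1 / (1 + \<delta>)) sequentially"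
  proof -
    have "(\<lambda>m::nat. sqrt (1 - 1 / real m)) \<longlonglongrightarrow> 1" "(\<lambda>m::nat. 2 / sqrt (real m)) \<longlonglongrightarrow> 0"
      by real_asymp+
    then have "(\<lambda>m::nat. sqrt (1 - 1 / real m) / (1 + \<delta>) - 2 / sqrt (real m)) \<longlonglongrightarrow> 1 / (1 + \<delta>) - 0"
      using \<delta> by (intro tendsto_diff tendsto_divide tendsto_const) auto
    then show ?thesis by simp
  qed
  moreover have "1 - \<epsilon> < 1 / (1 + \<delta>)"
  proof -
    have "(1 - \<epsilon>) * (1 + \<delta>) < 1" using assms by (simp add: \<delta>_def algebra_simps add_pos_pos)
    then show ?thesis using \<delta> by (simp add: field_simps)
  qed
  ultimately have "\<forall>\<^sub>F m in sequentially. 1 - \<epsilon> < sqrt (1 - 1 / real m) / (1 + \<delta>) - 2 / sqrt (real m)"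
    by (rule order_tendstoD)
  then obtain m :: nat where m: "m \<ge> 2" "1 - \<epsilon> < sqrt (1 - 1 / real m) / (1 + \<delta>) - 2 / sqrt (real m)"
    using eventually_happens'[OF _ eventually_conj[OF _ eventually_ge_at_top[of 2]]] by force
  define c where "c = 2 / ((1 + \<delta>) * t\<^sup>2)"
  have c: "c > 0" using t \<delta> by (simp add: c_def)
  define a where "a = block_start c m"
  interpret neg: bounded_iid M "\<lambda>n \<omega>. - X n \<omega>" "distr D borel uminus" \<sigma> K
    by (rule bounded_iid_uminus)
  have neg_S: "neg.S n \<omega> = - S n \<omega>" for n \<omega> by (simp add: neg.S_def S_def sum_negf)
  have "AE \<omega> in M. \<forall>\<^sub>F n in sequentially. - S n \<omega> < 2 * iterated_log_scale (\<sigma>\<^sup>2) (real n)"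
    using neg.eventually_less_iterated_log_scale[of 1] by (simp add: neg_S)
  moreover have "AE \<omega> in M. \<exists>\<^sub>F k in sequentially. S (a (Suc k)) \<omega> - S (a k) \<omega>
      \<ge> real (block_number c k) * (t * \<sigma> * sqrt (real m ^ k))"
    unfolding a_def c_def by (rule frequently_block_sum_ge[OF t(1) \<delta> m(1) t(2)])
  ultimately show ?thesis
  proof eventually_elim
    fix \<omega>
    assume neg_bound: "\<forall>\<^sub>F n in sequentially. - S n \<omega> < 2 * iterated_log_scale (\<sigma>\<^sup>2) (real n)"
      and freq: "\<exists>\<^sub>F k in sequentially. S (a (Suc k)) \<omega> - S (a k) \<omega>
      \<ge> real (block_number c k) * (t * \<sigma> * sqrt (real m ^ k))"
    have a_ge: "k \<le> a (Suc k)" for k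
      unfolding a_def using c m(1) by (intro block_start_ge) auto
    then have "filterlim (\<lambda>k. a (Suc k)) at_top sequentially"
      by (intro filterlim_at_top_mono[OF filterlim_ident] always_eventually allI)
    then have a_lim: "filterlim a at_top sequentially" by (simp only: filterlim_sequentially_Suc)
    from eventually_compose_filterlim[OF neg_bound a_lim]
    have "\<forall>\<^sub>F k in sequentially. - S (a k) \<omega> < 2 * iterated_log_scale (\<sigma>\<^sup>2) (real (a k))" .
    moreover have "\<forall>\<^sub>F k in sequentially. a k \<ge> 3"
      using a_lim unfolding filterlim_at_top by blast
    moreover have "\<forall>\<^sub>F k in sequentially. ln (ln (real (a (Suc k)))) \<le> (1 + \<delta>) * ln (real (Suc k))"
      unfolding a_def by (rule eventually_ln_ln_block_start_le[OF c m(1) \<delta>])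
    ultimately have good: "\<forall>\<^sub>F k in sequentially. - S (a k) \<omega> < 2 * iterated_log_scale (\<sigma>\<^sup>2) (real (a k)) \<and>
        a k \<ge> 3 \<and> ln (ln (real (a (Suc k)))) \<le> (1 + \<delta>) * ln (real (Suc k))"
      by eventually_elim simp
    have "\<exists>\<^sub>F k in sequentially. S (a (Suc k)) \<omega> \<ge> (1 - \<epsilon>) * iterated_log_scale (\<sigma>\<^sup>2) (real (a (Suc k)))"
      using frequently_eventually_conj[OF freq good]
    proof (rule frequently_elim1, elim conjE)
      fix k
      assume blk: "real (block_number c k) * (t * \<sigma> * sqrt (real m ^ k)) \<le> S (a (Suc k)) \<omega> - S (a k) \<omega>"
        and neg: "- S (a k) \<omega> < 2 * iterated_log_scale (\<sigma>\<^sup>2) (real (a k))"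
        and a3: "3 \<le> a k" and lnln: "ln (ln (real (a (Suc k)))) \<le> (1 + \<delta>) * ln (real (Suc k))"
      define n where "n = real (a (Suc k))"
      have "a k \<le> a (Suc k)" by (simp add: a_def block_start_Suc)
      then have n3: "n \<ge> 3" using a3 by (simp add: n_def)
      have pos: "iterated_log_scale (\<sigma>\<^sup>2) n \<ge> 0" using n3 by (intro iterated_log_scale_nonneg) auto
      have "iterated_log_scale (\<sigma>\<^sup>2) (real (a k)) \<le> iterated_log_scale (\<sigma>\<^sup>2) n / sqrt (real m)"
        unfolding n_def a_def using c m a3
        by (intro iterated_log_scale_block_start_le) (auto simp: a_def)
      moreover have "sqrt (1 - 1 / real m) / (1 + \<delta>) * iterated_log_scale (\<sigma>\<^sup>2) n \<le>
         real (block_number c k) * (t * \<sigma> * sqrt (real m ^ k))"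
        using n3 lnln unfolding n_def a_def c_def
        by (intro block_sum_bound_ge[OF t(1) \<delta> m(1) \<sigma>_pos])
      ultimately have "S (a (Suc k)) \<omega> \<ge> sqrt (1 - 1 / real m) / (1 + \<delta>) * iterated_log_scale (\<sigma>\<^sup>2) n
          - 2 * (iterated_log_scale (\<sigma>\<^sup>2) n / sqrt (real m))"
        using blk neg by linarith
      also have "sqrt (1 - 1 / real m) / (1 + \<delta>) * iterated_log_scale (\<sigma>\<^sup>2) n
          - 2 * (iterated_log_scale (\<sigma>\<^sup>2) n / sqrt (real m)) =
          (sqrt (1 - 1 / real m) / (1 + \<delta>) - 2 / sqrt (real m)) * iterated_log_scale (\<sigma>\<^sup>2) n"
        by (simp add: algebra_simps)
      finally have "(sqrt (1 - 1 / real m) / (1 + \<delta>) - 2 / sqrt (real m)) * iterated_log_scale (\<sigma>\<^sup>2) n \<le> S (a (Suc k)) \<omega>" .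
      moreover have "(1 - \<epsilon>) * iterated_log_scale (\<sigma>\<^sup>2) n \<le>
          (sqrt (1 - 1 / real m) / (1 + \<delta>) - 2 / sqrt (real m)) * iterated_log_scale (\<sigma>\<^sup>2) n"
        using m(2) pos by (intro mult_right_mono) auto
      ultimately show "(1 - \<epsilon>) * iterated_log_scale (\<sigma>\<^sup>2) (real (a (Suc k))) \<le> S (a (Suc k)) \<omega>"
        by (simp add: n_def)
    qed
    then show "\<exists>\<^sub>F n in sequentially. S n \<omega> \<ge> (1 - \<epsilon>) * iterated_log_scale (\<sigma>\<^sup>2) (real n)"
      unfolding frequently_sequentially using a_ge by (meson order_trans)
  qed
qed

end

section \<open>Almost sure limit theorems\<close>

lemma limsup_eq_1I:
  fixes x :: "nat \<Rightarrow> real"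
  assumes up: "\<And>i::nat. \<forall>\<^sub>F n in sequentially. x n < 1 + 1 / real (Suc i)"
    and low: "\<And>i::nat. \<exists>\<^sub>F n in sequentially. x n \<ge> 1 - 1 / real (Suc i)"
  shows "limsup (\<lambda>n. ereal (x n)) = 1"
proof (rule antisym; rule ccontr)
  assume "\<not> limsup (\<lambda>n. ereal (x n)) \<le> 1"
  then have "1 < limsup (\<lambda>n. ereal (x n))" by simp
  then obtain y where y: "1 < ereal y" "ereal y < limsup (\<lambda>n. ereal (x n))" using ereal_dense2 by blast
  have "0 < y - 1" using y(1) by simp
  then obtain i where i: "inverse (real (Suc i)) < y - 1" using reals_Archimedean by blast
  have "\<forall>\<^sub>F n in sequentially. ereal (x n) \<le> ereal y"
    using up[of i] by eventually_elim (use i in \<open>simp add: inverse_eq_divide\<close>)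
  then have "limsup (\<lambda>n. ereal (x n)) \<le> ereal y" by (rule Limsup_bounded)
  with y(2) show False by simp
next
  assume "\<not> 1 \<le> limsup (\<lambda>n. ereal (x n))"
  then have "limsup (\<lambda>n. ereal (x n)) < 1" by simp
  then obtain y where y: "limsup (\<lambda>n. ereal (x n)) < ereal y" "ereal y < 1" using ereal_dense2 by blast
  have "0 < 1 - y" using y(2) by simp
  then obtain i where i: "inverse (real (Suc i)) < 1 - y" using reals_Archimedean by blast
  have "\<forall>\<^sub>F n in sequentially. ereal (x n) < ereal y" using y(1) by (rule Limsup_lessD)
  then have "\<forall>\<^sub>F n in sequentially. \<not> x n \<ge> 1 - 1 / real (Suc i)"
    by eventually_elim (use i in \<open>simp add: inverse_eq_divide\<close>)
  with low[of i] show False by (simp add: frequently_def)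
qed

context bounded_iid begin

lemma AE_limsup_eq_1:
  "AE \<omega> in M. limsup (\<lambda>n. ereal (S n \<omega> / iterated_log_scale (\<sigma>\<^sup>2) (real n))) = 1"
proof -
  have pos: "\<forall>\<^sub>F n in sequentially. iterated_log_scale (\<sigma>\<^sup>2) (real n) > 0"
    unfolding iterated_log_scale_def using \<sigma>_pos by real_asymp
  have "AE \<omega> in M. \<forall>i::nat. \<forall>\<^sub>F n in sequentially. S n \<omega> < (1 + 1 / real (Suc i)) * iterated_log_scale (\<sigma>\<^sup>2) (real n)"
    unfolding AE_all_countable by (intro allI eventually_less_iterated_log_scale) simp
  moreover have "AE \<omega> in M. \<forall>i::nat. \<exists>\<^sub>F n in sequentially. S n \<omega> \<ge> (1 - 1 / real (Suc i)) * iterated_log_scale (\<sigma>\<^sup>2) (real n)"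
    unfolding AE_all_countable by (intro allI frequently_ge_iterated_log_scale) simp
  ultimately show ?thesis
  proof eventually_elim
    fix \<omega>
    assume up: "\<forall>i::nat. \<forall>\<^sub>F n in sequentially. S n \<omega> < (1 + 1 / real (Suc i)) * iterated_log_scale (\<sigma>\<^sup>2) (real n)"
      and low: "\<forall>i::nat. \<exists>\<^sub>F n in sequentially. S n \<omega> \<ge> (1 - 1 / real (Suc i)) * iterated_log_scale (\<sigma>\<^sup>2) (real n)"
    show "limsup (\<lambda>n. ereal (S n \<omega> / iterated_log_scale (\<sigma>\<^sup>2) (real n))) = 1"
    proof (rule limsup_eq_1I)
      fix i :: nat
      show "\<forall>\<^sub>F n in sequentially. S n \<omega> / iterated_log_scale (\<sigma>\<^sup>2) (real n) < 1 + 1 / real (Suc i)"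
        using up[rule_format, of i] pos by eventually_elim (simp only: pos_divide_less_eq)
      show "\<exists>\<^sub>F n in sequentially. S n \<omega> / iterated_log_scale (\<sigma>\<^sup>2) (real n) \<ge> 1 - 1 / real (Suc i)"
        using frequently_eventually_conj[OF low[rule_format, of i] pos]
        by (rule frequently_elim1) (simp only: pos_le_divide_eq)
    qed
  qed
qed

theorem law_of_the_iterated_logarithm:
  "AE \<omega> in M. limsup (\<lambda>n. ereal (S n \<omega> / iterated_log_scale (\<sigma>\<^sup>2) (real n))) = 1 \<and>
     liminf (\<lambda>n. ereal (S n \<omega> / iterated_log_scale (\<sigma>\<^sup>2) (real n))) = - 1"
proof -
  interpret neg: bounded_iid M "\<lambda>n \<omega>. - X n \<omega>" "distr D borel uminus" \<sigma> K
    by (rule bounded_iid_uminus)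
  have neg_S: "neg.S n \<omega> = - S n \<omega>" for n \<omega> by (simp add: neg.S_def S_def sum_negf)
  from AE_limsup_eq_1 neg.AE_limsup_eq_1 show ?thesis
  proof eventually_elim
    case (elim \<omega>)
    have "- liminf (\<lambda>n. ereal (S n \<omega> / iterated_log_scale (\<sigma>\<^sup>2) (real n))) =
      limsup (\<lambda>n. - ereal (S n \<omega> / iterated_log_scale (\<sigma>\<^sup>2) (real n)))"
      by (rule ereal_Limsup_uminus[symmetric])
    also have "\<dots> = 1" using elim(2) by (simp add: neg_S)
    finally have "liminf (\<lambda>n. ereal (S n \<omega> / iterated_log_scale (\<sigma>\<^sup>2) (real n))) = - 1"
      by (metis ereal_uminus_uminus)
    with elim(1) show ?case by simp
  qed
qed

text \<open>
  The scale of the iterated logarithm is \<open>o(n)\<close>, so the strong law comes for free.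
\<close>

theorem strong_law_of_large_numbers: "AE \<omega> in M. (\<lambda>n. S n \<omega> / real n) \<longlonglongrightarrow> 0"
proof -
  interpret neg: bounded_iid M "\<lambda>n \<omega>. - X n \<omega>" "distr D borel uminus" \<sigma> K
    by (rule bounded_iid_uminus)
  have neg_S: "neg.S n \<omega> = - S n \<omega>" for n \<omega> by (simp add: neg.S_def S_def sum_negf)
  have lim: "(\<lambda>n. 2 * iterated_log_scale (\<sigma>\<^sup>2) (real n) / real n) \<longlonglongrightarrow> 0"
    unfolding iterated_log_scale_def using \<sigma>_pos by real_asymp
  from eventually_less_iterated_log_scale[OF zero_less_one] neg.eventually_less_iterated_log_scale[OF zero_less_one]
  show ?thesis
  proof eventually_elim
    case (elim \<omega>)
    have "\<forall>\<^sub>F n in sequentially. norm (S n \<omega> / real n) \<le> 2 * iterated_log_scale (\<sigma>\<^sup>2) (real n) / real n"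
      using elim
    proof eventually_elim
      case (elim n)
      then have "\<bar>S n \<omega>\<bar> \<le> 2 * iterated_log_scale (\<sigma>\<^sup>2) (real n)" by (simp add: neg_S)
      then show ?case by (simp add: divide_right_mono)
    qed
    then show ?case using lim by (rule Lim_null_comparison)
  qed
qed

end

section \<open>The number of distinct values\<close>

context haar_sample begin

definition centred_jump :: "nat \<Rightarrow> 'w \<Rightarrow> real" where
  "centred_jump n \<omega> = real (J_r r (sample \<omega>) n) - p"

lemma measurable_centred_jump [measurable]: "centred_jump n \<in> borel_measurable M"
  unfolding centred_jump_def[abs_def] by measurable

lemma distr_J_r_eq:
  "distr M (count_space UNIV) (\<lambda>\<omega>. J_r r (sample \<omega>) n) = distr M (count_space UNIV) (\<lambda>\<omega>. J_r r (sample \<omega>) 0)"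
proof (rule measure_eqI_countable[of _ UNIV])
  fix k :: nat
  have "emeasure (distr M (count_space UNIV) (\<lambda>\<omega>. J_r r (sample \<omega>) n)) {k} =
      ennreal (if k = 0 then 1 - p else if k = 1 then p else 0)" for n
  proof -
    have "emeasure (distr M (count_space UNIV) (\<lambda>\<omega>. J_r r (sample \<omega>) n)) {k} =
      ennreal (prob {\<omega>\<in>space M. J_r r (sample \<omega>) n = k})"
      by (subst emeasure_distr) (auto simp: emeasure_eq_measure intro!: arg_cong[where f = prob])
    moreover have "prob {\<omega>\<in>space M. J_r r (sample \<omega>) n = k} = (if k = 0 then 1 - p else if k = 1 then p else 0)"
    proof (cases "k = 0 \<or> k = 1")
      case True
      then show ?thesis using prob_jump[of n] by (auto simp del: One_nat_def)
    next
      case False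
      then have "J_r r (sample \<omega>) n \<noteq> k" for \<omega> using J_r_cases[of "sample \<omega>" n] by auto
      then show ?thesis using False by simp
    qed
    ultimately show ?thesis by simp
  qed
  then show "emeasure (distr M (count_space UNIV) (\<lambda>\<omega>. J_r r (sample \<omega>) n)) {k} =
    emeasure (distr M (count_space UNIV) (\<lambda>\<omega>. J_r r (sample \<omega>) 0)) {k}" by simp
qed auto

lemma expectation_J_r: "expectation (\<lambda>\<omega>. real (J_r r (sample \<omega>) n)) = p"
  and integrable_J_r: "integrable M (\<lambda>\<omega>. real (J_r r (sample \<omega>) n))"
proof -
  let ?A = "{\<omega>\<in>space M. J_r r (sample \<omega>) n = 1}"
  have eq: "real (J_r r (sample \<omega>) n) = indicator ?A \<omega>" if "\<omega> \<in> space M" for \<omega>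
    using that J_r_cases[of "sample \<omega>" n] by (auto simp: indicator_def)
  have A: "?A \<in> events" by measurable
  have "expectation (\<lambda>\<omega>. real (J_r r (sample \<omega>) n)) = expectation (indicator ?A)"
    using eq by (intro Bochner_Integration.integral_cong) auto
  also have "\<dots> = p" using A prob_jump(2)[of n] by simp
  finally show "expectation (\<lambda>\<omega>. real (J_r r (sample \<omega>) n)) = p" .
  have "integrable M (indicator ?A :: 'w \<Rightarrow> real)" using A by (auto simp: emeasure_eq_measure)
  then show "integrable M (\<lambda>\<omega>. real (J_r r (sample \<omega>) n))"
    using eq by (subst Bochner_Integration.integrable_cong[OF refl]) auto
qed

lemma bounded_iid_centred_jump: "bounded_iid M centred_jump (distr M borel (centred_jump 0)) (sqrt (p * (1 - p))) 1"
proof unfold_locales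
  show "indep_vars (\<lambda>_. borel) centred_jump UNIV"
    unfolding centred_jump_def[abs_def] by (rule indep_vars_compose2[OF indep_vars_jumps]) simp
  show "distr M borel (centred_jump n) = distr M borel (centred_jump 0)" for n
  proof -
    have "distr M borel (centred_jump n) = distr (distr M (count_space UNIV) (\<lambda>\<omega>. J_r r (sample \<omega>) n)) borel (\<lambda>k. real k - p)" for n
      by (subst distr_distr) (auto simp: comp_def centred_jump_def[abs_def])
    then show ?thesis by (metis distr_J_r_eq)
  qed
  show mean: "expectation (centred_jump n) = 0" for n
    using integrable_J_r[of n] by (simp add: centred_jump_def[abs_def] expectation_J_r prob_space)
  show "variance (centred_jump n) = (sqrt (p * (1 - p)))\<^sup>2" for n
  proof -
    have "variance (centred_jump n) = expectation (\<lambda>\<omega>. (1 - 2 * p) * real (J_r r (sample \<omega>) n) + p\<^sup>2)"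
      unfolding mean
    proof (rule Bochner_Integration.integral_cong[OF refl])
      fix \<omega>
      show "(centred_jump n \<omega> - 0)\<^sup>2 = (1 - 2 * p) * real (J_r r (sample \<omega>) n) + p\<^sup>2"
        using J_r_cases[of "sample \<omega>" n] by (auto simp: centred_jump_def power2_eq_square algebra_simps)
    qed
    also have "\<dots> = (1 - 2 * p) * p + p\<^sup>2"
      using integrable_J_r[of n] by (simp add: expectation_J_r prob_space)
    also have "\<dots> = p * (1 - p)" by (simp add: power2_eq_square algebra_simps)
    finally show ?thesis using p_bounds by simp
  qed
  show "0 < sqrt (p * (1 - p))" using p_bounds by simp
  show "\<bar>centred_jump n \<omega>\<bar> \<le> 1" for n \<omega>
    using J_r_cases[of "sample \<omega>" n] p_bounds by (auto simp: centred_jump_def)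
qed

sublocale jumps: bounded_iid M centred_jump "distr M borel (centred_jump 0)" "sqrt (p * (1 - p))" 1
  by (rule bounded_iid_centred_jump)

lemma jumps_S: "jumps.S N \<omega> = real (C_r r (sample \<omega>) N) - 1 - real N * p"
  by (simp add: jumps.S_def centred_jump_def C_r_def sum_subtractf)

lemma jumps_variance: "(sqrt (p * (1 - p)))\<^sup>2 = p * (1 - p)"
  using p_bounds by simp

lemma measurable_C_r: "(\<lambda>\<omega>. C_r r (sample \<omega>) N) \<in> M \<rightarrow>\<^sub>M count_space UNIV"
  unfolding C_r_def by measurable

lemma C_r_binomial:
  "distr M (count_space UNIV) (\<lambda>\<omega>. C_r r (sample \<omega>) N - 1) = measure_pmf (binomial_pmf N p)"
  using distr_sum_J_r[of N] by (simp add: C_r_def)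

lemma C_r_strong_law: "AE \<omega> in M. (\<lambda>N. real (C_r r (sample \<omega>) N) / real N) \<longlonglongrightarrow> p"
  using jumps.strong_law_of_large_numbers
proof eventually_elim
  case (elim \<omega>)
  have "(\<lambda>N. jumps.S N \<omega> / real N + 1 / real N + p) \<longlonglongrightarrow> 0 + 0 + p"
    using elim by (intro tendsto_add tendsto_const lim_1_over_n)
  moreover have "\<forall>\<^sub>F N in sequentially. jumps.S N \<omega> / real N + 1 / real N + p = real (C_r r (sample \<omega>) N) / real N"
    using eventually_gt_at_top[of 0] by eventually_elim (simp add: jumps_S field_simps)
  ultimately show ?case by (simp add: tendsto_cong)
qed

lemma C_r_central_limit:
  "weak_conv_m
     (\<lambda>N. distr M borel (\<lambda>\<omega>. (real (C_r r (sample \<omega>) N) - 1 - real N * p) / sqrt (real N * p * (1 - p))))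
     std_normal_distribution"
proof -
  have "weak_conv_m (\<lambda>N. distr M borel (\<lambda>\<omega>. (\<Sum>i<N. centred_jump i \<omega>) / sqrt (real N * (sqrt (p * (1 - p)))\<^sup>2)))
     std_normal_distribution"
    by (rule central_limit_theorem_zero_mean[OF jumps.indep jumps.mean jumps.\<sigma>_pos
          jumps.integrable_X_square jumps.variance jumps.law])
  then show ?thesis
    by (simp only: jumps.S_def[symmetric] jumps_S jumps_variance mult.assoc)
qed

lemma C_r_iterated_logarithm:
  "AE \<omega> in M.
     limsup (\<lambda>N. ereal ((real (C_r r (sample \<omega>) N) - 1 - real N * p) /
       sqrt (2 * real N * p * (1 - p) * ln (ln (real N))))) = 1 \<and>
     liminf (\<lambda>N. ereal ((real (C_r r (sample \<omega>) N) - 1 - real N * p) /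
       sqrt (2 * real N * p * (1 - p) * ln (ln (real N))))) = -1"
proof -
  have "iterated_log_scale ((sqrt (p * (1 - p)))\<^sup>2) x = sqrt (2 * x * p * (1 - p) * ln (ln x))" for x
    unfolding jumps_variance iterated_log_scale_def by (simp only: mult.assoc)
  then show ?thesis using jumps.law_of_the_iterated_logarithm by (simp only: jumps_S)
qed

end

theorem corollary4p8:
  fixes M :: "'w measure"
    and \<mu> :: "'a::{field,finite} fls measure"
    and \<alpha> :: "nat \<Rightarrow> 'w \<Rightarrow> 'a fls"
    and r q :: nat
    and p :: real
  assumes "q = CARD('a)"
    and "r \<ge> 1"
    and "p = 1 - 1 / real q ^ r"
    and "prob_space M"
    and "is_haar_probability \<mu>"
    and "prob_space.indep_vars M (\<lambda>_. \<mu>) \<alpha> {1..r}"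
    and "\<And>i. i \<in> {1..r} \<Longrightarrow> distr M \<mu> (\<alpha> i) = \<mu>"
  defines "CN \<equiv> \<lambda>N \<omega>. C_r r (\<lambda>i. \<alpha> i \<omega>) N"
  shows
    "(\<forall>N\<ge>1. \<forall>\<omega>\<in>space M. CN N \<omega> = card (L_r r (\<lambda>i. \<alpha> i \<omega>) ` {0..N})) \<and>
     (\<forall>N\<ge>1. CN N \<in> M \<rightarrow>\<^sub>M count_space UNIV \<and>
        distr M (count_space UNIV) (\<lambda>\<omega>. CN N \<omega> - 1) = measure_pmf (binomial_pmf N p)) \<and>
     (AE \<omega> in M. (\<lambda>N. real (CN N \<omega>) / real N) \<longlonglongrightarrow> p) \<and>
     weak_conv_m
       (\<lambda>N. distr M borel
          (\<lambda>\<omega>. (real (CN N \<omega>) - 1 - real N * p) / sqrt (real N * p * (1 - p))))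
       std_normal_distribution \<and>
     (AE \<omega> in M.
        limsup (\<lambda>N. ereal ((real (CN N \<omega>) - 1 - real N * p) /
          sqrt (2 * real N * p * (1 - p) * ln (ln (real N))))) = 1 \<and>
        liminf (\<lambda>N. ereal ((real (CN N \<omega>) - 1 - real N * p) /
          sqrt (2 * real N * p * (1 - p) * ln (ln (real N))))) = -1)"
proof -
  interpret H: haar_sample M \<mu> \<alpha> r
    using assms(2,4-7) by (simp add: haar_sample_def haar_sample_axioms_def)
  have p: "p = H.p" using assms(1,3) by (simp add: H.p_def)
  show ?thesis
    unfolding CN_def p
    using C_r_eq_card H.measurable_C_r H.C_r_binomial H.C_r_strong_law H.C_r_central_limit
      H.C_r_iterated_logarithm
    by blast
qed

end
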